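(* Let $(\Gamma,d_0)$ be a compact metric space with $d_0\le 1$, let $\mu$ be a Borel probability measure on $\Gamma$, and let $a>0$, $0\le b<1$, $\beta\ge 0$. For $f\in\mathcal F$ (the class of $d_1$-Lipschitz functions on the configuration space $\mathcal H$) let $h_f(\xi)=-\int_0^\infty\big(\mathbb E f(\mathbf Z_\xi(t))-\boldsymbol\pi(f)\big)\,dt$, where $\mathbf Z_\xi(\cdot)$ is the birth-death system with parameters $a,b,\beta,\mu$ started from $\xi$, and $\boldsymbol\pi$ is its invariant distribution. For $n\ge 0$ put $$C_n=\sup\{|h_f(\xi+\delta_x)-h_f(\xi+\delta_y)|:\ f\in\mathcal F,\ \xi\in\mathcal H,\ |\xi|=n,\ x,y\in\Gamma\},$$ and for a function $h$ on $\mathcal H$ put $$\Delta_2h(\xi)=\sup_{x,y\in\Gamma}\big|h(\xi+\delta_x+\delta_y)-h(\xi+\delta_x)-h(\xi+\delta_y)+h(\xi)\big|.$$ Then: (i) for every $n\ge 0$, $$C_n\le\min\left\{1,\ \frac{1}{2(n+1)}+\frac1a,\ \frac{1}{(a\wedge b)(n+1)}\right\}$$ (the last entry being read as $+\infty$ when $b=0$); (ii) for every $f\in\mathcal F$ and $\xi\in\mathcal H$, $$\Delta_2h_f(\xi)\le\frac{2}{|\xi|+1}+\frac5a.$$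
   Context: $\mathcal H$ is the set of finite nonnegative-integer-valued Borel measures (configurations) $\xi=\sum_{i=1}^n\delta_{x_i}$ on $\Gamma$ (repeated points allowed), $|\xi|=n$ is the total mass, and $\mathcal H$ carries the smallest $\sigma$-algebra making $\xi\mapsto\xi(C)$ measurable for all Borel $C\subset\Gamma$. Metric $d_1$ on $\mathcal H$: for $\xi=\sum_{i=1}^n\delta_{x_i}$, $\eta=\sum_{i=1}^n\delta_{y_i}$ with $n\ge1$, $d_1(\xi,\eta)=\min_\sigma\frac1n\sum_{i=1}^nd_0(x_i,y_{\sigma(i)})$ over permutations $\sigma$ of $\{1,\dots,n\}$; $d_1(\xi,\eta)=1$ if $|\xi|\ne|\eta|$; $d_1=0$ if $|\xi|=|\eta|=0$. $\mathcal F=\{f:\mathcal H\to\mathbb R:\ |f(\xi)-f(\eta)|\le d_1(\xi,\eta)\ \forall\,\xi,\eta\in\mathcal H\}$. Birth-death system with parameters $a,b,\beta,\mu$: the $\mathcal H$-valued pure jump Markov process $\mathbf Z_\xi(\cdot)$ with $\mathbf Z_\xi(0)=\xi$ and generator $$\mathscr A h(\xi)=(a+b|\xi|)\int_\Gamma\big(h(\xi+\delta_x)-h(\xi)\big)\mu(dx)+\big(1+\beta(|\xi|-1)\big)\int_\Gamma\big(h(\xi-\delta_x)-h(\xi)\big)\xi(dx).$$ Thus $|\mathbf Z_\xi(\cdot)|$ is an ergodic birth-death process with birth rates $\alpha_k=a+bk$ and death rates $\beta_k=k+\beta k(k-1)$; new particles are placed according to $\mu$, and at a death a uniformly chosen particle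 is removed. Its unique invariant distribution is $\boldsymbol\pi=\mathcal L\big(\sum_{i=1}^Z\delta_{U_i}\big)$, where $Z$ has the invariant distribution of the birth-death process with rates $(\alpha_k),(\beta_k)$ and is independent of the i.i.d. $\mu$-distributed $U_1,U_2,\dots$. $\boldsymbol\pi(f)=\int f\,d\boldsymbol\pi$. The integral defining $h_f$ converges absolutely for bounded $f$ (in particular for $f\in\mathcal F$). *)

theory Defs
  imports "HOL-Probability.Probability"
begin

text \<open>
  Configurations, i.e. finite sums of unit point masses on the ground space, are represented by
  finite multisets: \<open>add_mset x \<xi>\<close> is $\xi+\delta_x$, \<open>\<xi> - {#x#}\<close> is $\xi-\delta_x$,
  \<open>size \<xi>\<close> is $|\xi|$, \<open>\<Sum>x\<in>#\<xi>. g x\<close> is the integral of \<open>g\<close> against \<open>\<xi>\<close>, and the mass that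
  \<open>\<xi>\<close> gives to \<open>C\<close> is \<open>size (filter_mset (\<lambda>x. x \<in> C) \<xi>)\<close>.
\<close>

definition config_space :: "'a::topological_space multiset measure" where
  "config_space =
     sigma UNIV {(\<lambda>\<xi>. size (filter_mset (\<lambda>x. x \<in> C) \<xi>)) -` N | C N. C \<in> sets borel}"

text \<open>
  The minimum also ranges over all enumerations of the two configurations; as
  \<open>d1_mset\<close> below shows, this does not change its value.
\<close>

definition d1 :: "'a::metric_space multiset \<Rightarrow> 'a multiset \<Rightarrow> real" where
  "d1 \<xi> \<eta> =
     (if size \<xi> \<noteq> size \<eta> then 1
      else if size \<xi> = 0 then 0
      else Min {(1 / real (size \<xi>)) * (\<Sum>i<size \<xi>. dist (xs ! i) (ys ! \<sigma> i)) | xs ys \<sigma>.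
                  mset xs = \<xi> \<and> mset ys = \<eta> \<and> \<sigma> permutes {..<size \<xi>}})"

lemma d1_mset:
  fixes xs ys :: "'a::metric_space list"
  assumes len: "length xs = n" "length ys = n" and n: "n \<ge> 1"
  shows "d1 (mset xs) (mset ys) =
    Min ((\<lambda>\<sigma>. (1 / real n) * (\<Sum>i<n. dist (xs ! i) (ys ! \<sigma> i))) ` {\<sigma>. \<sigma> permutes {..<n}})"
proof -
  have "{(1 / real n) * (\<Sum>i<n. dist (us ! i) (vs ! \<sigma> i)) | us vs \<sigma>.
            mset us = mset xs \<and> mset vs = mset ys \<and> \<sigma> permutes {..<n}} =
        (\<lambda>\<sigma>. (1 / real n) * (\<Sum>i<n. dist (xs ! i) (ys ! \<sigma> i))) ` {\<sigma>. \<sigma> permutes {..<n}}"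
    (is "?L = ?R")
  proof
    show "?L \<subseteq> ?R"
    proof clarify
      fix us vs \<sigma>
      assume us: "mset us = mset xs" and vs: "mset vs = mset ys" and \<sigma>: "\<sigma> permutes {..<n}"
      obtain p where p: "p permutes {..<n}" "permute_list p xs = us"
        using mset_eq_permutation[OF us] len by auto
      obtain q where q: "q permutes {..<n}" "permute_list q ys = vs"
        using mset_eq_permutation[OF vs] len by auto
      have in_p: "p i < n" if "i < n" for i
        using permutes_in_image[OF p(1), of i] that by simp
      have in_\<sigma>: "\<sigma> i < n" if "i < n" for i
        using permutes_in_image[OF \<sigma>, of i] that by simp
      have "(\<Sum>i<n. dist (us ! i) (vs ! \<sigma> i)) = (\<Sum>i<n. dist (xs ! p i) (ys ! q (\<sigma> i)))"
        using p q len in_\<sigma> by (intro sum.cong) (auto simp: permute_list_nth)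
      also have "\<dots> = (\<Sum>i<n. dist (xs ! i) (ys ! (q \<circ> \<sigma> \<circ> inv p) i))"
        using p(1) in_p
        by (subst sum.permute[OF p(1), of "\<lambda>i. dist (xs ! i) (ys ! (q \<circ> \<sigma> \<circ> inv p) i)"])
           (simp add: o_def permutes_inverses(2)[OF p(1)])
      finally show "(1 / real n) * (\<Sum>i<n. dist (us ! i) (vs ! \<sigma> i)) \<in> ?R"
        using permutes_compose[OF permutes_compose[OF permutes_inv[OF p(1)] \<sigma>] q(1)]
        by (intro image_eqI[where x = "q \<circ> \<sigma> \<circ> inv p"]) (auto simp: o_assoc)
    qed
  qed auto
  then show ?thesis
    using len n unfolding d1_def by auto
qed

definition lipschitz_class :: "('a::metric_space multiset \<Rightarrow> real) set" where
  "lipschitz_class = {f. \<forall>\<xi> \<eta>. \<bar>f \<xi> - f \<eta>\<bar> \<le> d1 \<xi> \<eta>}"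

definition bd_generator ::
  "real \<Rightarrow> real \<Rightarrow> real \<Rightarrow> 'a measure \<Rightarrow> ('a multiset \<Rightarrow> real) \<Rightarrow> 'a multiset \<Rightarrow> real" where
  "bd_generator a b \<beta> \<mu> h \<xi> =
     (a + b * real (size \<xi>)) * (\<integral>x. (h (add_mset x \<xi>) - h \<xi>) \<partial>\<mu>) +
     (1 + \<beta> * (real (size \<xi>) - 1)) * (\<Sum>x\<in>#\<xi>. (h (\<xi> - {#x#}) - h \<xi>))"

definition past ::
  "'w measure \<Rightarrow> (real \<Rightarrow> 'w \<Rightarrow> 'a::topological_space multiset) \<Rightarrow> real \<Rightarrow> 'w measure" where
  "past \<Omega> X s =
     sigma (space \<Omega>) {X u -` A \<inter> space \<Omega> | u A. 0 \<le> u \<and> u \<le> s \<and> A \<in> sets config_space}"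

definition transition ::
  "('a::topological_space multiset \<Rightarrow> 'w measure) \<Rightarrow> ('a multiset \<Rightarrow> real \<Rightarrow> 'w \<Rightarrow> 'a multiset)
     \<Rightarrow> real \<Rightarrow> 'a multiset \<Rightarrow> 'a multiset measure" where
  "transition M Z t \<xi> = distr (M \<xi>) config_space (Z \<xi> t)"

text \<open>
  The birth-death system as a Markov family: for every initial configuration \<open>\<xi>\<close> a process
  \<open>Z \<xi>\<close> on some probability space \<open>M \<xi>\<close>. Pure jump means that the paths are right-continuous
  step functions: at every time they are constant on a right neighbourhood and on a punctured left
  neighbourhood, so by compactness there are finitely many jumps in each bounded time interval.
  The birth rates are in general unbounded, so \<open>bd_generator a b \<beta> \<mu> h\<close> need not be bounded, and
  the generator is the pointwise derivative at time 0 of the expectation of \<open>h\<close>, for bounded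
  measurable \<open>h\<close>.
\<close>

locale birth_death_system =
  fixes a b \<beta> :: real
    and \<mu> :: "'a::metric_space measure"
    and M :: "'a multiset \<Rightarrow> 'w measure"
    and Z :: "'a multiset \<Rightarrow> real \<Rightarrow> 'w \<Rightarrow> 'a multiset"
  assumes prob_space_M: "prob_space (M \<xi>)"
    and measurable_Z: "0 \<le> t \<Longrightarrow> Z \<xi> t \<in> M \<xi> \<rightarrow>\<^sub>M config_space"
    and start: "AE \<omega> in M \<xi>. Z \<xi> 0 \<omega> = \<xi>"
    and pure_jump: "AE \<omega> in M \<xi>.
        (\<forall>t\<ge>0. eventually (\<lambda>s. Z \<xi> s \<omega> = Z \<xi> t \<omega>) (at_right t)) \<and>
        (\<forall>t>0. \<exists>\<eta>. eventually (\<lambda>s. Z \<xi> s \<omega> = \<eta>) (at_left t))"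
    and kernel: "0 \<le> t \<Longrightarrow> transition M Z t \<in> config_space \<rightarrow>\<^sub>M prob_algebra config_space"
    and markov: "\<lbrakk>0 \<le> s; 0 \<le> t; h \<in> borel_measurable config_space; bounded (range h)\<rbrakk> \<Longrightarrow>
        AE \<omega> in M \<xi>. real_cond_exp (M \<xi>) (past (M \<xi>) (Z \<xi>) s) (\<lambda>\<omega>. h (Z \<xi> (s + t) \<omega>)) \<omega> =
          (\<integral>\<eta>. h \<eta> \<partial>transition M Z t (Z \<xi> s \<omega>))"
    and generator: "\<lbrakk>h \<in> borel_measurable config_space; bounded (range h)\<rbrakk> \<Longrightarrow>
        ((\<lambda>t. ((\<integral>\<omega>. h (Z \<xi> t \<omega>) \<partial>M \<xi>) - h \<xi>) / t) \<longlongrightarrow> bd_generator a b \<beta> \<mu> h \<xi>) (at_right 0)"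

definition invariant_distribution ::
  "('a::topological_space multiset \<Rightarrow> 'w measure) \<Rightarrow> ('a multiset \<Rightarrow> real \<Rightarrow> 'w \<Rightarrow> 'a multiset)
     \<Rightarrow> 'a multiset measure \<Rightarrow> bool" where
  "invariant_distribution M Z \<pi> \<longleftrightarrow>
     prob_space \<pi> \<and> sets \<pi> = sets config_space \<and> (\<forall>t\<ge>0. bind \<pi> (transition M Z t) = \<pi>)"

definition stein_solution ::
  "('a multiset \<Rightarrow> 'w measure) \<Rightarrow> ('a multiset \<Rightarrow> real \<Rightarrow> 'w \<Rightarrow> 'a multiset)
     \<Rightarrow> 'a multiset measure \<Rightarrow> ('a multiset \<Rightarrow> real) \<Rightarrow> 'a multiset \<Rightarrow> real" where
  "stein_solution M Z \<pi> f \<xi> =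
     - (LBINT t:{0..}. ((\<integral>\<omega>. f (Z \<xi> t \<omega>) \<partial>M \<xi>) - (\<integral>\<eta>. f \<eta> \<partial>\<pi>)))"

text \<open>The suprema are taken in the extended reals, so that they are meaningful without a prior
  boundedness proof.\<close>

definition C_const ::
  "('a::metric_space multiset \<Rightarrow> 'w measure) \<Rightarrow> ('a multiset \<Rightarrow> real \<Rightarrow> 'w \<Rightarrow> 'a multiset)
     \<Rightarrow> 'a multiset measure \<Rightarrow> nat \<Rightarrow> ereal" where
  "C_const M Z \<pi> n =
     Sup {ereal \<bar>stein_solution M Z \<pi> f (add_mset x \<xi>) - stein_solution M Z \<pi> f (add_mset y \<xi>)\<bar>
          | f \<xi> x y. f \<in> lipschitz_class \<and> size \<xi> = n}"

definition Delta2 :: "('a multiset \<Rightarrow> real) \<Rightarrow> 'a multiset \<Rightarrow> ereal" where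
  "Delta2 h \<xi> =
     (SUP (x, y) \<in> UNIV. ereal \<bar>h (\<xi> + {#x#} + {#y#}) - h (\<xi> + {#x#}) - h (\<xi> + {#y#}) + h \<xi>\<bar>)"

end

theory Submission
  imports Defs
begin

text \<open>
  Write $P_t$ for the semigroup, $\mathscr A$ for the generator, $\alpha_k = a + bk$, and
  $\beta_k = k\gamma_k$ with $\gamma_k = 1 + \beta(k-1)$. Couplings and first passage times are
  replaced by comparison principles, so no strong Markov property is needed. A parabolic comparison
  gives $|P_tf(\xi+\delta_x) - P_tf(\xi)| \le e^{-(1-b)t}$, hence exponential ergodicity and the
  Poisson equation $\mathscr A h_f = f - \boldsymbol\pi(f)$. For (i), the difference
  $h_f(\xi+\delta_x) - h_f(\xi+\delta_y)$ with $k = |\xi|+1$ is a subsolution of the equation of a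
  tagged particle, for which $1$, $1/(2k) + 1/a$ and $1/((a \wedge b)k)$ are supersolutions.

  For (ii) let $\eta = \xi + \delta_x$ and $k = |\eta|$. Moving single particles, the second
  difference is within $3(1/(2k) + 1/a)$ of $G + D$, where $G$ is the mean change of $h_f$ when a
  $\mu$-distributed particle is added to $\eta$ and $D$ the mean change when a uniformly chosen one is
  removed. By the Poisson equation $\alpha_k G + \beta_k D = f(\eta) - \boldsymbol\pi(f)$. If
  $\beta_k > \alpha_k$, then $G$ is bounded through the excursion from size $k+1$ down to $k$: it
  lasts at most $1/(\beta_k - \alpha_k)$ in the mean and replaces at most
  $\beta_k/(\beta_k - \alpha_k)$ particles of $\eta$ in the mean; if $\beta_k < \alpha_k$, the
  excursion from $k-1$ up to $k$ bounds $D$. In both cases $|G + D| \le 1/a + (1/(2k) + 1/a)$.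
\<close>
section \<open>Comparison principles\<close>

text \<open>The generator is given on bounded functions only, and only as a right derivative at time
  0, while the total rates are unbounded and \<open>h\<close> may grow linearly: no maximum is
  attained a priori. Each comparison subtracts a supersolution, where necessary with a small
  multiple of a function growing in the number of particles, so that positive values occur only
  where the rates are bounded; the small multiple then tends to 0.

  The excursion bounds contain m = inf f - \<pi>(f) and blow up when births and deaths nearly
  balance. Both defects vanish in G + D. Put F = f - \<pi>(f), let C bound the effect of moving one
  particle, and let \<delta> = \<beta>_k - \<alpha>_k > 0. The Poisson equation reads \<beta>_k (G +
  D) = F(\<eta>) + \<delta> G, the excursion gives \<delta> G \<le> - m + C \<beta>_k, and F \<le> m
  + 1. What remains is 1/\<beta>_k + C, with \<beta>_k > \<alpha>_k \<ge> a; the opposite drift is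
  symmetric. Bounds are proved from above only; the other sign comes from exchanging x and y, or
  from passing to -f.\<close>

lemma right_derivative_nonpos_imp_le:
  fixes \<phi> :: "real \<Rightarrow> real"
  assumes "0 \<le> T" and cont: "continuous_on {0..T} \<phi>"
    and der: "\<And>t. 0 \<le> t \<Longrightarrow> t < T \<Longrightarrow> (\<phi> has_real_derivative D t) (at_right t)"
    and D: "\<And>t. 0 \<le> t \<Longrightarrow> t < T \<Longrightarrow> D t \<le> 0"
  shows "\<phi> T \<le> \<phi> 0"
proof -
  have *: "\<phi> T - e * T \<le> \<phi> 0" if "e > 0" for e
  proof (rule ccontr)
    define \<psi> where "\<psi> t = \<phi> t - e * t" for t
    assume "\<not> \<phi> T - e * T \<le> \<phi> 0"
    then have T: "\<psi> T > \<psi> 0" by (simp add: \<psi>_def)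
    have c\<psi>: "continuous_on {0..T} \<psi>" unfolding \<psi>_def by (intro continuous_intros cont)
    \<comment> \<open>The last time at which \<open>\<psi>\<close> is not above its initial value.
      It is attained by continuity and lies before \<open>T\<close>; the negative right derivative
      there produces a later such time.\<close>
    define K where "K = {0..T} \<inter> \<psi> -` {..\<psi> 0}"
    have "closed K" unfolding K_def
      by (rule continuous_closed_preimage[OF c\<psi>]) auto
    moreover have "0 \<in> K" using \<open>0 \<le> T\<close> by (simp add: K_def)
    moreover have bdd: "bdd_above K" unfolding K_def by (rule bdd_aboveI[of _ T]) auto
    ultimately have s: "Sup K \<in> K" using closed_contains_Sup[of K] by auto
    define s where "s = Sup K"
    have sT: "0 \<le> s" "s < T" "\<psi> s \<le> \<psi> 0" using s T
      by (auto simp: K_def s_def order.strict_iff_order)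
    have "(\<psi> has_real_derivative D s - e) (at_right s)" unfolding \<psi>_def
      by (auto intro!: derivative_eq_intros der sT)
    moreover have "D s - e < 0" using D[OF sT(1,2)] \<open>e > 0\<close> by simp
    ultimately obtain d where d: "d > 0" "\<And>h. h > 0 \<Longrightarrow> s + h \<in> {s<..} \<Longrightarrow> h < d \<Longrightarrow> \<psi> s > \<psi> (s + h)"
      using has_real_derivative_neg_dec_right by blast
    define h where "h = min (d / 2) (T - s)"
    have "h > 0" "h < d" "s + h \<le> T" using d sT by (auto simp: h_def)
    then have "s + h \<in> K" using d(2)[of h] sT by (auto simp: K_def)
    then have "s + h \<le> s" unfolding s_def using bdd by (rule cSup_upper)
    then show False using \<open>h > 0\<close> by simp
  qed
  show ?thesis
  proof (rule field_le_epsilon)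
    fix e :: real assume "e > 0"
    then have "\<phi> T - e / (T + 1) * T \<le> \<phi> 0" using \<open>0 \<le> T\<close> by (intro *) simp
    moreover have "e / (T + 1) * T \<le> e" using \<open>0 \<le> T\<close> \<open>e > 0\<close> by (simp add: field_simps)
    ultimately show "\<phi> T \<le> \<phi> 0 + e" by simp
  qed
qed

text \<open>
  If \<open>v'\<close> is a jump generator with total rates \<open>q\<close>, possibly with killing, applied to \<open>v\<close>, then
  \<open>v' t i \<le> q i * (m - v t i)\<close> for every nonnegative upper bound \<open>m\<close> of \<open>v t\<close>. Only this consequence
  is assumed. The rates need to be bounded only where \<open>v\<close> is positive, which in the applications is
  enforced by subtracting a function that grows with the number of particles.
\<close>

lemma parabolic_comparison:
  fixes v v' :: "real \<Rightarrow> 'i \<Rightarrow> real" and q :: "'i \<Rightarrow> real"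
  assumes cont: "\<And>i. continuous_on {0..T} (\<lambda>t. v t i)"
    and der: "\<And>i t. 0 \<le> t \<Longrightarrow> t < T \<Longrightarrow> ((\<lambda>s. v s i) has_real_derivative v' t i) (at_right t)"
    and init: "\<And>i. v 0 i \<le> 0"
    and bdd: "\<And>i t. 0 \<le> t \<Longrightarrow> t \<le> T \<Longrightarrow> v t i \<le> B"
    and conf: "\<And>i t. 0 \<le> t \<Longrightarrow> t \<le> T \<Longrightarrow> v t i > 0 \<Longrightarrow> q i \<le> Q"
    and sub: "\<And>i t m. 0 \<le> t \<Longrightarrow> t < T \<Longrightarrow> 0 \<le> m \<Longrightarrow> (\<And>j. v t j \<le> m) \<Longrightarrow>
      v' t i \<le> q i * (m - v t i)"
    and t: "0 \<le> t" "t \<le> T"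
  shows "v t i \<le> 0"
proof -
  define I where "I = {0..T} \<times> (UNIV :: 'i set)"
  define m where "m = (SUP (s, j) \<in> I. max 0 (v s j))"
  have bd: "bdd_above ((\<lambda>(s, j). max 0 (v s j)) ` I)"
    by (rule bdd_aboveI[of _ "max 0 B"]) (clarsimp simp: I_def, meson bdd max.coboundedI2)
  have up: "max 0 (v s j) \<le> m" if "0 \<le> s" "s \<le> T" for s j
    unfolding m_def using cSUP_upper[OF _ bd, of "(s, j)"] that by (auto simp: I_def)
  have m0: "0 \<le> m" using up[OF t] by (meson max.bounded_iff)
  \<comment> \<open>At a point with \<open>v s j > 0\<close> the rate is at most \<open>Q\<close>,
    so integrating \<open>v' \<le> q * (m - v)\<close> from a nonpositive start leaves
    \<open>v s j \<le> m * (1 - \<theta>)\<close> with \<open>\<theta>\<close> independent of the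
    point. Passing to the supremum gives \<open>m \<le> m * (1 - \<theta>)\<close>, hence
    \<open>m \<le> 0\<close>.\<close>
  define \<theta> where "\<theta> = exp (- (max 0 Q * T))"
  have \<theta>: "0 < \<theta>" "\<theta> \<le> 1" using t by (auto simp: \<theta>_def)
  have "max 0 (v s j) \<le> m * (1 - \<theta>)" if s: "0 \<le> s" "s \<le> T" for s j
  proof (cases "v s j > 0")
    case False
    then show ?thesis using m0 \<theta> by (auto simp: max_def)
  next
    case True
    let ?q = "q j"
    have qQ: "?q \<le> Q" using conf[OF s True] .
    have "exp (?q * s) * (v s j - m) \<le> exp (?q * 0) * (v 0 j - m)"
    proof (rule right_derivative_nonpos_imp_le[where \<phi> = "\<lambda>s. exp (?q * s) * (v s j - m)" and
          D = "\<lambda>s. exp (?q * s) * (v' s j - ?q * (m - v s j))"])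
      show "continuous_on {0..s} (\<lambda>s. exp (?q * s) * (v s j - m))"
        by (intro continuous_intros continuous_on_subset[OF cont]) (use s in auto)
      fix r assume r: "0 \<le> r" "r < s"
      have dr: "((\<lambda>s. v s j) has_real_derivative v' r j) (at_right r)"
        using r s by (intro der) auto
      show "((\<lambda>s. exp (?q * s) * (v s j - m)) has_real_derivative
          exp (?q * r) * (v' r j - ?q * (m - v r j))) (at_right r)"
        by (rule derivative_eq_intros dr refl | simp)+ (simp add: algebra_simps)
      have "v r i \<le> m" for i using up[of r i] r s by auto
      then show "exp (?q * r) * (v' r j - ?q * (m - v r j)) \<le> 0"
        using sub[of r m j] r s m0 by (auto simp: mult_nonneg_nonpos)
    qed (use s in auto)
    also have "\<dots> \<le> - m" using init[of j] by simp
    finally have "v s j - m \<le> - m * exp (- (?q * s))"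
      by (simp add: exp_minus field_simps)
    moreover have "\<theta> \<le> exp (- (?q * s))"
    proof -
      have "?q * s \<le> max 0 Q * s" using qQ s by (intro mult_right_mono) auto
      also have "\<dots> \<le> max 0 Q * T" using s by (intro mult_left_mono) auto
      finally show ?thesis by (simp add: \<theta>_def)
    qed
    ultimately have "v s j - m \<le> - m * \<theta>"
      using mult_left_mono[OF _ m0] by (smt (verit, best) mult_minus_left)
    then show ?thesis using True by (simp add: algebra_simps)
  qed
  moreover have "(0::real, i) \<in> I" using t by (auto simp: I_def)
  ultimately have "m \<le> m * (1 - \<theta>)" unfolding m_def
    by (intro cSUP_least) (auto simp: I_def m_def)
  then have "m \<le> 0" using \<theta> by (smt (verit) m0 mult_le_cancel_left1)
  then show ?thesis using up[OF t, of i] by simp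
qed

text \<open>The supremum \<open>m\<close> need not be attained, hence the strict gain
  \<open>e\<close> and the common rate bound \<open>Q\<close> at positive points: within
  \<open>\<kappa>\<close> of the supremum the right side is at most \<open>Q * \<kappa>\<close>,
  which is less than \<open>e\<close>.\<close>

lemma elliptic_comparison:
  fixes v :: "'i \<Rightarrow> real"
  assumes bdd: "\<And>i. i \<in> I \<Longrightarrow> v i \<le> B" and "e > 0"
    and sub: "\<And>i m. i \<in> I \<Longrightarrow> v i > 0 \<Longrightarrow> (\<And>j. j \<in> I \<Longrightarrow> v j \<le> m) \<Longrightarrow> e \<le> Q * (m - v i)"
    and "i \<in> I"
  shows "v i \<le> 0"
proof (rule ccontr)
  assume "\<not> v i \<le> 0"
  then have pos: "v i > 0" by simp
  define m where "m = (SUP i \<in> I. v i)"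
  have up: "v j \<le> m" if "j \<in> I" for j
    unfolding m_def using that by (intro cSUP_upper bdd_aboveI2[of _ _ B] bdd)
  have "e \<le> Q * (m - v i)" by (rule sub[OF \<open>i \<in> I\<close> pos up])
  then have "Q > 0" using \<open>e > 0\<close> up[OF \<open>i \<in> I\<close>]
    by (smt (verit) mult_nonneg_nonneg mult_nonpos_nonneg)
  \<comment> \<open>The bound \<open>v i\<close> makes every point within \<open>\<kappa>\<close> of
    the supremum positive, so that \<open>sub\<close> applies there; the other bound makes
    \<open>Q * \<kappa> < e\<close>.\<close>
  define \<kappa> where "\<kappa> = min (v i) (e / Q / 2)"
  have k: "\<kappa> > 0" "Q * \<kappa> < e" using pos \<open>e > 0\<close> \<open>Q > 0\<close>
    by (auto simp: \<kappa>_def min_def field_simps)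
  have "\<exists>j\<in>I. m - \<kappa> < v j"
    using less_cSUP_iff[of I v "m - \<kappa>"] \<open>i \<in> I\<close> k bdd_aboveI2[of I v B] bdd
    by (auto simp: m_def)
  then obtain j where j: "j \<in> I" "m - \<kappa> < v j" by blast
  show False
  proof (cases "v j > 0")
    case True
    have "e \<le> Q * (m - v j)" by (rule sub[OF j(1) True up])
    also have "\<dots> \<le> Q * \<kappa>" using j \<open>Q > 0\<close> by (intro mult_left_mono) auto
    finally show False using k by simp
  next
    case False
    then have "m < v i" using j by (auto simp: \<kappa>_def)
    then show False using up[OF \<open>i \<in> I\<close>] by simp
  qed
qed

section \<open>Configurations\<close>

lemma space_config_space [simp]: "space config_space = UNIV"
  by (simp add: config_space_def space_measure_of_conv)

lemma measurable_into_config_space: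
  fixes f :: "'b \<Rightarrow> 'a::topological_space multiset"
  assumes "\<And>C. C \<in> sets borel \<Longrightarrow>
    (\<lambda>x. size (filter_mset (\<lambda>y. y \<in> C) (f x))) \<in> M \<rightarrow>\<^sub>M count_space UNIV"
  shows "f \<in> M \<rightarrow>\<^sub>M config_space"
  unfolding config_space_def
proof (rule measurable_measure_of)
  fix A :: "'a multiset set" assume "A \<in> {(\<lambda>\<xi>. size (filter_mset (\<lambda>x. x \<in> C) \<xi>)) -` N | C N. C \<in> sets borel}"
  then obtain C N where A: "A = (\<lambda>\<xi>. size (filter_mset (\<lambda>x. x \<in> C) \<xi>)) -` N" and C: "C \<in> sets borel"
    by auto
  show "f -` A \<inter> space M \<in> sets M"
    using measurable_sets[OF assms[OF C], of N] by (simp add: A vimage_def)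
qed auto

lemma measurable_mass:
  assumes "C \<in> sets borel"
  shows "(\<lambda>\<xi>. size (filter_mset (\<lambda>x. x \<in> C) \<xi>)) \<in> config_space \<rightarrow>\<^sub>M count_space UNIV"
  by (rule measurableI) (use assms in \<open>auto simp: config_space_def space_measure_of_conv\<close>)

lemma measurable_size_config [measurable]: "size \<in> config_space \<rightarrow>\<^sub>M count_space UNIV"
  using measurable_mass[of UNIV] by simp

lemma measurable_add_mset_config [measurable]:
  "(\<lambda>x. add_mset x \<xi>) \<in> borel \<rightarrow>\<^sub>M config_space"
proof (rule measurable_into_config_space)
  fix C :: "'a set" assume [measurable]: "C \<in> sets borel"
  have "(\<lambda>x. if x \<in> C then Suc (size (filter_mset (\<lambda>y. y \<in> C) \<xi>))
      else size (filter_mset (\<lambda>y. y \<in> C) \<xi>)) \<in> borel \<rightarrow>\<^sub>M count_space UNIV"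
    by measurable
  then show "(\<lambda>x. size (filter_mset (\<lambda>y. y \<in> C) (add_mset x \<xi>))) \<in> borel \<rightarrow>\<^sub>M count_space UNIV"
    by (rule measurable_cong[THEN iffD1, rotated]) auto
qed

lemma subset_mset_size_eq:
  assumes "A \<subseteq># B" "size A = size B"
  shows "A = B"
proof -
  have "size (B - A) = 0" using assms by (simp add: size_Diff_submset)
  then have "B - A = {#}" by simp
  then show ?thesis using subset_mset.diff_add[OF assms(1)] by simp
qed

lemma size_diff_commute:
  fixes A B :: "'a multiset"
  assumes "size A = size B"
  shows "size (A - B) = size (B - A)"
proof -
  have "A - B + B = B - A + A" by (rule multiset_eqI) simp
  then have "size (A - B + B) = size (B - A + A)" by simp
  then show ?thesis using assms by simp
qed

text \<open>The masses of the fibres over the finitely many points of \<open>N\<close> give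
  \<open>N \<subseteq># image_mset J \<xi>\<close>, and equal total mass forces equality.
  Restricting to these points makes the event a finite intersection of measurable ones.\<close>

lemma image_mset_eq_iff_mass:
  "image_mset J \<xi> = N \<longleftrightarrow>
     size \<xi> = size N \<and> (\<forall>i\<in>#N. size (filter_mset (\<lambda>x. x \<in> J -` {i}) \<xi>) = count N i)"
proof -
  have mass: "size (filter_mset (\<lambda>x. x \<in> J -` {i}) \<xi>) = count (image_mset J \<xi>) i" for i
    by (induction \<xi>) auto
  have "image_mset J \<xi> = N"
    if "size \<xi> = size N" and count: "\<forall>i\<in>#N. count (image_mset J \<xi>) i = count N i"
  proof -
    have "count N i \<le> count (image_mset J \<xi>) i" for i
      using count by (cases "i \<in># N") (auto simp: not_in_iff)
    then have "N \<subseteq># image_mset J \<xi>" by (rule mset_subset_eqI)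
    from subset_mset_size_eq[OF this] that(1) show ?thesis by simp
  qed
  then show ?thesis unfolding mass by auto
qed

lemma sets_image_mset_eq:
  assumes "\<And>i. J -` {i} \<in> sets borel"
  shows "{\<xi>. image_mset J \<xi> = N} \<in> sets config_space"
proof -
  have m: "{\<xi>. size (filter_mset (\<lambda>x. x \<in> J -` {i}) \<xi>) = count N i} \<in> sets config_space" for i
    using measurable_sets[OF measurable_mass[OF assms[of i]], of "{count N i}"]
    by (simp add: vimage_def)
  have s: "{\<xi>. size \<xi> = size N} \<in> sets config_space"
    using measurable_sets[OF measurable_size_config, of "{size N}"] by (simp add: vimage_def)
  have "{\<xi>. image_mset J \<xi> = N} = {\<xi>. size \<xi> = size N} \<inter>
      {\<xi> \<in> space config_space. \<forall>i\<in>set_mset N. \<xi> \<in> {\<xi>. size (filter_mset (\<lambda>x. x \<in> J -` {i}) \<xi>) = count N i}}"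
    by (auto simp: image_mset_eq_iff_mass)
  also have "\<dots> \<in> sets config_space"
    using m by (intro sets.Int s sets.sets_Collect_finite_All) simp_all
  finally show ?thesis .
qed

lemma singleton_in_sets_config_space: "{\<xi> :: 'a::t1_space multiset} \<in> sets config_space"
  using sets_image_mset_eq[of "\<lambda>x. x :: 'a" \<xi>] by (simp add: vimage_def)

section \<open>The metric \<open>d1\<close> and measurability of Lipschitz functions\<close>

lemma d1_le_mean_dist:
  assumes "length xs = n" "length ys = n" "n \<ge> 1"
  shows "d1 (mset xs) (mset ys) \<le> (\<Sum>i<n. dist (xs ! i) (ys ! i)) / real n"
proof -
  have "d1 (mset xs) (mset ys) \<le> 1 / real n * (\<Sum>i<n. dist (xs ! i) (ys ! id i))"
    unfolding d1_mset[OF assms]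
    by (intro Min_le image_eqI[where x = id] finite_imageI finite_permutations)
      (simp_all add: permutes_id)
  then show ?thesis by simp
qed

lemma d1_le_one:
  assumes "\<forall>x y :: 'a::metric_space. dist x y \<le> 1"
  shows "d1 (\<xi> :: 'a multiset) \<eta> \<le> 1"
proof (cases "size \<xi> = size \<eta> \<and> size \<xi> \<noteq> 0")
  case True
  obtain xs ys where xs: "\<xi> = mset xs" "\<eta> = mset ys" by (metis ex_mset)
  have "d1 \<xi> \<eta> \<le> (\<Sum>i<length xs. dist (xs ! i) (ys ! i)) / real (length xs)"
    unfolding xs using True by (intro d1_le_mean_dist) (auto simp: xs Suc_le_eq)
  also have "\<dots> \<le> (\<Sum>i<length xs. 1) / real (length xs)"
    using assms by (intro divide_right_mono sum_mono) auto
  finally show ?thesis using True by (simp add: xs divide_right_mono)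
qed (auto simp: d1_def)

lemma d1_add_mset_le:
  assumes "\<forall>x y :: 'a::metric_space. dist x y \<le> 1"
  shows "d1 (add_mset (x :: 'a) \<xi>) (add_mset y \<xi>) \<le> 1 / (real (size \<xi>) + 1)"
proof -
  obtain xs where xs: "\<xi> = mset xs" by (metis ex_mset)
  have "d1 (mset (x # xs)) (mset (y # xs)) \<le>
      (\<Sum>i<Suc (length xs). dist ((x # xs) ! i) ((y # xs) ! i)) / real (Suc (length xs))"
    by (intro d1_le_mean_dist) auto
  also have "\<dots> = dist x y / (real (length xs) + 1)"
    by (subst sum.lessThan_Suc_shift) (simp add: add.commute)
  also have "\<dots> \<le> 1 / (real (length xs) + 1)"
    using assms by (intro divide_right_mono) auto
  finally show ?thesis by (simp add: xs)
qed

lemma d1_image_mset_le: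
  assumes "\<And>x. dist (x :: 'a::metric_space) (\<phi> x) \<le> e" "0 \<le> e"
  shows "d1 \<xi> (image_mset \<phi> \<xi>) \<le> e"
proof (cases "\<xi> = {#}")
  case False
  obtain xs where xs: "\<xi> = mset xs" by (metis ex_mset)
  have "d1 (mset xs) (mset (map \<phi> xs)) \<le>
      (\<Sum>i<length xs. dist (xs ! i) (map \<phi> xs ! i)) / real (length xs)"
    using False by (intro d1_le_mean_dist) (auto simp: xs Suc_le_eq)
  also have "\<dots> \<le> (\<Sum>i<length xs. e) / real (length xs)"
    using assms by (intro divide_right_mono sum_mono) auto
  finally show ?thesis using False by (simp add: xs)
qed (use assms in \<open>simp add: d1_def\<close>)

text \<open>Compactness gives a finite net. Moving every particle to a nearby net point changes
  \<open>f\<close> by at most the mesh, and the modified function depends on \<xi> only through the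
  numbers of particles per cell, which take countably many values. So \<open>f\<close> is a uniform
  limit of measurable functions.\<close>

lemma lipschitz_class_measurable:
  fixes f :: "'a::metric_space multiset \<Rightarrow> real"
  assumes comp: "compact (UNIV :: 'a set)" and f: "f \<in> lipschitz_class"
  shows "f \<in> borel_measurable config_space"
proof -
  have "\<exists>g. g \<in> borel_measurable config_space \<and> (\<forall>\<xi>. \<bar>f \<xi> - g \<xi>\<bar> \<le> 1 / real (Suc n))" for n
  proof -
    define e where "e = 1 / real (Suc n)"
    have "e > 0" by (simp add: e_def)
    then obtain P :: "'a set" where P: "finite P" "UNIV \<subseteq> (\<Union>x\<in>P. ball x e)"
      using comp unfolding compact_eq_totally_bounded by blast
    then obtain p m where p: "P = p ` {i::nat. i < m}"
      using finite_imp_nat_seg_image_inj_on by metis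
    \<comment> \<open>Taking the least index makes each cell a ball minus finitely many balls, hence
      Borel.\<close>
    define J where "J x = (LEAST i. dist (p i) x < e)" for x
    have close: "dist (p (J x)) x < e" for x
    proof -
      obtain i where "dist (p i) x < e" using P(2) unfolding p by (fastforce simp: subset_eq)
      then show ?thesis unfolding J_def by (rule LeastI)
    qed
    have "J -` {i} = ball (p i) e - (\<Union>j<i. ball (p j) e)" for i
    proof (intro equalityI subsetI)
      fix x assume "x \<in> J -` {i}"
      then show "x \<in> ball (p i) e - (\<Union>j<i. ball (p j) e)"
        using close[of x] by (auto simp: J_def dest: not_less_Least)
    next
      fix x assume "x \<in> ball (p i) e - (\<Union>j<i. ball (p j) e)"
      then have "dist (p i) x < e" "\<And>j. dist (p j) x < e \<Longrightarrow> i \<le> j"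
        by (auto simp: not_less[symmetric])
      then show "x \<in> J -` {i}"
        unfolding J_def by (auto intro: Least_equality)
    qed
    then have J: "J -` {i} \<in> sets borel" for i
      by (auto intro!: sets.Diff sets.finite_UN)
    define g where "g \<xi> = f (image_mset p (image_mset J \<xi>))" for \<xi>
    have "image_mset J \<in> config_space \<rightarrow>\<^sub>M count_space UNIV"
    proof (subst measurable_count_space_eq_countable)
      show "countable (UNIV :: nat multiset set)"
        by (metis countable_image countableI_type surj_mset)
    qed (use sets_image_mset_eq[OF J] in \<open>auto simp: vimage_def\<close>)
    from measurable_compose[OF this, of "\<lambda>N. f (image_mset p N)" borel]
    have "g \<in> borel_measurable config_space" by (simp add: g_def[abs_def])
    moreover have "\<bar>f \<xi> - g \<xi>\<bar> \<le> e" for \<xi>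
    proof -
      have "\<bar>f \<xi> - g \<xi>\<bar> \<le> d1 \<xi> (image_mset (\<lambda>x. p (J x)) \<xi>)"
        using f by (simp add: lipschitz_class_def g_def multiset.map_comp o_def)
      also have "\<dots> \<le> e"
        using close \<open>e > 0\<close> by (intro d1_image_mset_le) (auto simp: dist_commute less_imp_le)
      finally show ?thesis .
    qed
    ultimately show ?thesis by (auto simp: e_def)
  qed
  then obtain g where g: "\<And>n. g n \<in> borel_measurable config_space"
    "\<And>n \<xi>. \<bar>f \<xi> - g n \<xi>\<bar> \<le> 1 / real (Suc n)" by metis
  show ?thesis
  proof (rule borel_measurable_LIMSEQ_real)
    fix \<xi> :: "'a multiset"
    have "(\<lambda>n. f \<xi> - g n \<xi>) \<longlonglongrightarrow> 0"
      by (rule Lim_null_comparison[OF _ LIMSEQ_Suc[OF lim_1_over_n]]) (use g(2) in auto)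
    from tendsto_diff[OF tendsto_const this, of "f \<xi>"] show "(\<lambda>n. g n \<xi>) \<longlonglongrightarrow> f \<xi>"
      by simp
  qed (rule g)
qed

text \<open>Removing \<open>w\<close> from \<zeta> raises the number of missing particles of \<eta>
  by one exactly when \<open>count \<zeta> w \<le> count \<eta> w\<close>. The particles of \<zeta>
  with this property form a submultiset of \<eta>, so there are at most \<open>size \<eta>\<close>
  of them.\<close>

lemma size_diff_remove_sum:
  fixes \<zeta> \<eta> :: "'a multiset"
  shows "(\<Sum>w\<in>#\<zeta>. size (\<eta> - (\<zeta> - {#w#}))) \<le> size \<zeta> * size (\<eta> - \<zeta>) + size \<eta>"
proof -
  have sum_filter: "(\<Sum>w\<in>#A. k + (if Q w then 1 else 0)) = size A * k + size (filter_mset Q A)"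
    for A :: "'a multiset" and k Q
    by (induction A) auto
  have eq: "size (\<eta> - (\<zeta> - {#w#})) = size (\<eta> - \<zeta>) + (if count \<zeta> w \<le> count \<eta> w then 1 else 0)"
    if w: "w \<in># \<zeta>" for w
  proof (cases "count \<zeta> w \<le> count \<eta> w")
    case True
    have "\<eta> - (\<zeta> - {#w#}) = add_mset w (\<eta> - \<zeta>)"
      using True w by (intro multiset_eqI) (auto simp: in_diff_count count_greater_zero_iff[symmetric] simp del: count_greater_zero_iff)
    then show ?thesis using True by simp
  next
    case False
    have "\<eta> - (\<zeta> - {#w#}) = \<eta> - \<zeta>"
      using False w by (intro multiset_eqI) auto
    then show ?thesis using False by simp
  qed
  have "(\<Sum>w\<in>#\<zeta>. size (\<eta> - (\<zeta> - {#w#}))) =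
      (\<Sum>w\<in>#\<zeta>. size (\<eta> - \<zeta>) + (if count \<zeta> w \<le> count \<eta> w then 1 else 0))"
    by (intro arg_cong[where f = sum_mset] image_mset_cong eq)
  also have "\<dots> = size \<zeta> * size (\<eta> - \<zeta>) + size (filter_mset (\<lambda>w. count \<zeta> w \<le> count \<eta> w) \<zeta>)"
    by (rule sum_filter)
  also have "filter_mset (\<lambda>w. count \<zeta> w \<le> count \<eta> w) \<zeta> \<subseteq># \<eta>"
    by (intro mset_subset_eqI) auto
  then have "size (filter_mset (\<lambda>w. count \<zeta> w \<le> count \<eta> w) \<zeta>) \<le> size \<eta>"
    by (rule size_mset_mono)
  finally show ?thesis by simp
qed

section \<open>The generator and the semigroup\<close>

lemma sum_mset_le:
  fixes g :: "'a \<Rightarrow> real"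
  assumes "\<And>w. w \<in># \<xi> \<Longrightarrow> g w \<le> K"
  shows "(\<Sum>w\<in>#\<xi>. g w) \<le> real (size \<xi>) * K"
  using assms by (induction \<xi>) (auto simp: algebra_simps intro: add_mono)

lemma sum_mset_minus:
  fixes g h :: "'a \<Rightarrow> real"
  shows "(\<Sum>w\<in>#\<xi>. (g w - h w)) = (\<Sum>w\<in>#\<xi>. g w) - (\<Sum>w\<in>#\<xi>. h w)"
  by (induction \<xi>) auto

lemma size_remove_real: "w \<in># \<xi> \<Longrightarrow> real (size (\<xi> - {#w#})) = real (size \<xi>) - 1"
  by (metis add_diff_cancel_right' insert_DiffM of_nat_Suc size_add_mset add.commute)

locale bd_rates =
  fixes a b \<beta> :: real and \<mu> :: "'a::metric_space measure"
  assumes prob_space_\<mu>: "prob_space \<mu>" and sets_\<mu>: "sets \<mu> = sets borel"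
    and a_pos: "a > 0" and b_nonneg: "0 \<le> b" and b_less: "b < 1" and \<beta>_nonneg: "\<beta> \<ge> 0"
begin

sublocale \<mu>: prob_space \<mu> by (rule prob_space_\<mu>)

lemma measurable_\<mu>_eq: "\<mu> \<rightarrow>\<^sub>M N = borel \<rightarrow>\<^sub>M N"
  by (rule measurable_cong_sets[OF sets_\<mu> refl])

abbreviation gen :: "('a multiset \<Rightarrow> real) \<Rightarrow> 'a multiset \<Rightarrow> real" where
  "gen \<equiv> bd_generator a b \<beta> \<mu>"

lemma integrable_add_mset:
  fixes g :: "'a multiset \<Rightarrow> real"
  assumes "g \<in> borel_measurable config_space" "\<And>\<xi>. \<bar>g \<xi>\<bar> \<le> B"
  shows "integrable \<mu> (\<lambda>x. g (add_mset x \<xi>))"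
  by (rule \<mu>.integrable_const_bound[of _ B])
    (use assms measurable_compose[OF measurable_add_mset_config assms(1)] in
      \<open>auto simp: measurable_\<mu>_eq\<close>)

lemma integral_increment_le:
  assumes "integrable \<mu> (\<lambda>x. u (add_mset x \<xi>) :: real)" "\<And>x. u (add_mset x \<xi>) \<le> K"
  shows "(\<integral>x. (u (add_mset x \<xi>) - c) \<partial>\<mu>) \<le> K - c"
proof -
  have "(\<integral>x. (u (add_mset x \<xi>) - c) \<partial>\<mu>) \<le> (\<integral>x. (K - c) \<partial>\<mu>)"
    using assms by (intro integral_mono) auto
  then show ?thesis by (simp add: \<mu>.prob_space)
qed

text \<open>For \<open>n = 0\<close> the second factor is 1 - \<beta>, which may be negative; the
  factor \<open>n\<close> then vanishes.\<close>

lemma death_factor_nonneg: "0 \<le> real n * (1 + \<beta> * (real n - 1))"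
  using \<beta>_nonneg by (cases n) auto

lemma gen_le:
  assumes int: "integrable \<mu> (\<lambda>x. u (add_mset x \<xi>))"
    and K1: "\<And>x. u (add_mset x \<xi>) \<le> K1" and K2: "\<And>w. w \<in># \<xi> \<Longrightarrow> u (\<xi> - {#w#}) \<le> K2"
  shows "gen u \<xi> \<le> (a + b * real (size \<xi>)) * (K1 - u \<xi>) +
    real (size \<xi>) * (1 + \<beta> * (real (size \<xi>) - 1)) * (K2 - u \<xi>)"
proof -
  have "(\<Sum>w\<in>#\<xi>. (u (\<xi> - {#w#}) - u \<xi>)) \<le> real (size \<xi>) * (K2 - u \<xi>)"
    using K2 by (intro sum_mset_le) auto
  then have "(1 + \<beta> * (real (size \<xi>) - 1)) * (\<Sum>w\<in>#\<xi>. (u (\<xi> - {#w#}) - u \<xi>)) \<le>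
      (1 + \<beta> * (real (size \<xi>) - 1)) * (real (size \<xi>) * (K2 - u \<xi>))"
    using \<beta>_nonneg by (cases "size \<xi>") (auto intro!: mult_left_mono)
  moreover have "(a + b * real (size \<xi>)) * (\<integral>x. (u (add_mset x \<xi>) - u \<xi>) \<partial>\<mu>) \<le>
      (a + b * real (size \<xi>)) * (K1 - u \<xi>)"
    using a_pos b_nonneg by (intro mult_left_mono integral_increment_le int K1) auto
  ultimately show ?thesis unfolding bd_generator_def by (simp add: mult_ac)
qed

lemma gen_add_mset:
  "gen u (add_mset x \<xi>) = (a + b * (real (size \<xi>) + 1)) *
      (\<integral>z. (u (add_mset z (add_mset x \<xi>)) - u (add_mset x \<xi>)) \<partial>\<mu>) +
    (1 + \<beta> * real (size \<xi>)) * (u \<xi> - u (add_mset x \<xi>) +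
      (\<Sum>w\<in>#\<xi>. (u (add_mset x (\<xi> - {#w#})) - u (add_mset x \<xi>))))"
proof -
  have "(\<Sum>w\<in>#\<xi>. (u (add_mset x \<xi> - {#w#}) - u (add_mset x \<xi>))) =
      (\<Sum>w\<in>#\<xi>. (u (add_mset x (\<xi> - {#w#})) - u (add_mset x \<xi>)))"
    by (intro arg_cong[where f = sum_mset] image_mset_cong) (auto simp: insert_DiffM2 diff_union_single_conv)
  then show ?thesis unfolding bd_generator_def by (simp add: add.commute)
qed

text \<open>Expresses the generator through one-particle increments alone, as if \<xi> and \<xi> + x
  ran together. The terms are the extra birth rate \<open>b\<close> due to \<open>x\<close>, the
  common births, the common deaths together with the death of \<open>x\<close>, and the additional
  death rate \<beta> that \<open>x\<close> inflicts on every other particle.\<close>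

lemma gen_increment:
  fixes u :: "'a multiset \<Rightarrow> real"
  assumes int: "\<And>\<xi>. integrable \<mu> (\<lambda>x. u (add_mset x \<xi>))"
  defines "e \<equiv> \<lambda>\<xi> x. u (add_mset x \<xi>) - u \<xi>"
  shows "gen u (add_mset x \<xi>) - gen u \<xi> =
    b * (\<integral>z. e (add_mset x \<xi>) z \<partial>\<mu>) +
    (a + b * real (size \<xi>)) * (\<integral>z. (e (add_mset z \<xi>) x - e \<xi> x) \<partial>\<mu>) +
    (1 + \<beta> * real (size \<xi>)) * ((\<Sum>w\<in>#\<xi>. (e (\<xi> - {#w#}) x - e \<xi> x)) - e \<xi> x) -
    \<beta> * (\<Sum>w\<in>#\<xi>. e (\<xi> - {#w#}) w)"
proof -
  have i1: "(\<integral>z. (e (add_mset z \<xi>) x - e \<xi> x) \<partial>\<mu>) =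
      (\<integral>z. e (add_mset x \<xi>) z \<partial>\<mu>) - (\<integral>z. e \<xi> z \<partial>\<mu>)"
    using int by (subst Bochner_Integration.integral_diff[symmetric])
      (auto simp: e_def add_mset_commute \<mu>.prob_space intro!: Bochner_Integration.integral_cong)
  have s1: "(\<Sum>w\<in>#\<xi>. e (\<xi> - {#w#}) w) = - (\<Sum>w\<in>#\<xi>. (u (\<xi> - {#w#}) - u \<xi>))"
  proof -
    have "(\<Sum>w\<in>#\<xi>. e (\<xi> - {#w#}) w) = (\<Sum>w\<in>#\<xi>. (u \<xi> - u (\<xi> - {#w#})))"
      by (intro arg_cong[where f = sum_mset] image_mset_cong) (auto simp: e_def)
    then show ?thesis by (simp add: sum_mset_minus)
  qed
  have s2: "(\<Sum>w\<in>#\<xi>. (e (\<xi> - {#w#}) x - e \<xi> x)) =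
      (\<Sum>w\<in>#\<xi>. (u (add_mset x (\<xi> - {#w#})) - u (add_mset x \<xi>))) - (\<Sum>w\<in>#\<xi>. (u (\<xi> - {#w#}) - u \<xi>))"
    by (simp only: sum_mset_minus[symmetric] e_def) (simp add: algebra_simps)
  show ?thesis
    unfolding gen_add_mset i1 s1 s2
    unfolding bd_generator_def e_def by (simp add: algebra_simps)
qed
end

section \<open>The semigroup of transition operators\<close>

locale bd_semigroup = birth_death_system a b \<beta> \<mu> M Z + bd_rates a b \<beta> \<mu>
  for a b \<beta> :: real and \<mu> :: "'a::metric_space measure"
    and M :: "'a multiset \<Rightarrow> 'w measure" and Z :: "'a multiset \<Rightarrow> real \<Rightarrow> 'w \<Rightarrow> 'a multiset"
begin

definition P :: "real \<Rightarrow> ('a multiset \<Rightarrow> real) \<Rightarrow> 'a multiset \<Rightarrow> real" where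
  "P t g \<xi> = (\<integral>\<omega>. g (Z \<xi> t \<omega>) \<partial>M \<xi>)"

lemma P_eq_transition:
  assumes "0 \<le> t" "g \<in> borel_measurable config_space"
  shows "P t g \<xi> = (\<integral>\<eta>. g \<eta> \<partial>transition M Z t \<xi>)"
  unfolding P_def transition_def
  by (rule integral_distr[symmetric]) (use assms measurable_Z in auto)

lemma P_measurable:
  assumes "0 \<le> t" "g \<in> borel_measurable config_space"
  shows "P t g \<in> borel_measurable config_space"
proof -
  have "(\<lambda>\<xi>. \<integral>\<eta>. g \<eta> \<partial>transition M Z t \<xi>) \<in> borel_measurable config_space"
    using measurable_compose[OF measurable_prob_algebraD[OF kernel[OF assms(1)]]
        integral_measurable_subprob_algebra[OF assms(2)]] .
  then show ?thesis using P_eq_transition[OF assms] by (simp add: fun_eq_iff[symmetric] cong: measurable_cong)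
qed

lemma P_integrable:
  fixes g :: "'a multiset \<Rightarrow> real"
  assumes "0 \<le> t" "g \<in> borel_measurable config_space" "\<And>\<xi>. \<bar>g \<xi>\<bar> \<le> B"
  shows "integrable (M \<xi>) (\<lambda>\<omega>. g (Z \<xi> t \<omega>))"
proof -
  interpret prob_space "M \<xi>" by (rule prob_space_M)
  show ?thesis
    using assms measurable_compose[OF measurable_Z[OF assms(1)] assms(2)]
    by (intro integrable_const_bound[of _ B]) auto
qed

lemma P_abs_le:
  assumes "0 \<le> t" "g \<in> borel_measurable config_space" "\<And>\<xi>. \<bar>g \<xi>\<bar> \<le> B"
  shows "\<bar>P t g \<xi>\<bar> \<le> B"
proof -
  interpret prob_space "M \<xi>" by (rule prob_space_M)
  have "\<bar>P t g \<xi>\<bar> \<le> (\<integral>\<omega>. \<bar>g (Z \<xi> t \<omega>)\<bar> \<partial>M \<xi>)"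
    unfolding P_def by (rule integral_abs_bound)
  also have "\<dots> \<le> (\<integral>\<omega>. B \<partial>M \<xi>)"
    using assms P_integrable[OF assms] by (intro integral_mono) auto
  finally show ?thesis by (simp add: prob_space)
qed

lemma P_0:
  assumes "g \<in> borel_measurable config_space"
  shows "P 0 g \<xi> = g \<xi>"
proof -
  interpret prob_space "M \<xi>" by (rule prob_space_M)
  have "P 0 g \<xi> = (\<integral>\<omega>. g \<xi> \<partial>M \<xi>)"
    unfolding P_def using start[of \<xi>] measurable_compose[OF measurable_Z[of 0] assms]
    by (intro integral_cong_AE) auto
  then show ?thesis by (simp add: prob_space)
qed

lemma P_semigroup:
  assumes st: "0 \<le> s" "0 \<le> t" and g: "g \<in> borel_measurable config_space" "\<And>\<xi>. \<bar>g \<xi>\<bar> \<le> B"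
  shows "P (s + t) g \<xi> = P s (P t g) \<xi>"
proof -
  interpret prob_space "M \<xi>" by (rule prob_space_M)
  let ?F = "past (M \<xi>) (Z \<xi>) s"
  have "subalgebra (M \<xi>) ?F"
    unfolding subalgebra_def past_def
    using measurable_sets[OF measurable_Z]
    by (auto intro!: sets.sigma_sets_subset simp: space_measure_of_conv sets_measure_of_conv)
  then interpret finite_measure_subalgebra "M \<xi>" ?F
    by unfold_locales
  have int: "integrable (M \<xi>) (\<lambda>\<omega>. g (Z \<xi> (s + t) \<omega>))"
    using st g by (intro P_integrable) auto
  have bd: "bounded (range g)" using g(2) by (auto simp: bounded_iff)
  have "P (s + t) g \<xi> = (\<integral>\<omega>. real_cond_exp (M \<xi>) ?F (\<lambda>\<omega>. g (Z \<xi> (s + t) \<omega>)) \<omega> \<partial>M \<xi>)"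
    unfolding P_def using real_cond_exp_int(2)[OF int] by simp
  also have "\<dots> = (\<integral>\<omega>. (\<integral>\<eta>. g \<eta> \<partial>transition M Z t (Z \<xi> s \<omega>)) \<partial>M \<xi>)"
  proof (rule integral_cong_AE)
    show "real_cond_exp (M \<xi>) ?F (\<lambda>\<omega>. g (Z \<xi> (s + t) \<omega>)) \<in> borel_measurable (M \<xi>)"
      by (rule borel_measurable_cond_exp2)
    show "(\<lambda>\<omega>. \<integral>\<eta>. g \<eta> \<partial>transition M Z t (Z \<xi> s \<omega>)) \<in> borel_measurable (M \<xi>)"
      using measurable_compose[OF measurable_Z[OF st(1)] P_measurable[OF st(2) g(1)]]
      by (simp add: P_eq_transition[OF st(2) g(1)])
  qed (use markov[OF st g(1) bd, of \<xi>] in simp)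
  also have "\<dots> = P s (P t g) \<xi>"
    unfolding P_def[of s] by (simp add: P_eq_transition[OF st(2) g(1)])
  finally show ?thesis .
qed

text \<open>\<open>P t g\<close> is again bounded and measurable, so the generator at time 0 applies
  to it, and the semigroup property shifts the difference quotient to time \<open>t\<close>. This
  reaches increments to the right only.\<close>

lemma P_right_derivative:
  assumes t: "0 \<le> t" and g: "g \<in> borel_measurable config_space" "\<And>\<xi>. \<bar>g \<xi>\<bar> \<le> B"
  shows "((\<lambda>s. P s g \<xi>) has_real_derivative bd_generator a b \<beta> \<mu> (P t g) \<xi>) (at_right t)"
proof -
  have "bounded (range (P t g))"
    using P_abs_le[OF t g] by (auto simp: bounded_iff)
  from generator[OF P_measurable[OF t g(1)] this, of \<xi>]
  have "((\<lambda>s. (P s (P t g) \<xi> - P t g \<xi>) / s) \<longlongrightarrow> bd_generator a b \<beta> \<mu> (P t g) \<xi>) (at_right 0)"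
    by (simp add: P_def[of _ "P t g"])
  moreover have "eventually (\<lambda>s. (P s (P t g) \<xi> - P t g \<xi>) / s = (P (s + t) g \<xi> - P t g \<xi>) / (s + t - t))
      (at_right 0)"
    using P_semigroup[OF _ t g] by (auto simp: eventually_at_filter)
  ultimately have "((\<lambda>s. (P (s + t) g \<xi> - P t g \<xi>) / (s + t - t)) \<longlongrightarrow>
      bd_generator a b \<beta> \<mu> (P t g) \<xi>) (at_right 0)"
    by (rule Lim_transform_eventually)
  then show ?thesis
    unfolding has_field_derivative_iff
    by (subst filterlim_at_right_to_0) (simp add: add.commute)
qed

text \<open>
  The modulus of continuity is governed by the probability of leaving \<open>\<xi>\<close> within time \<open>s\<close>, which
  does not depend on \<open>t\<close>; this yields continuity from the left, on which the generator at time 0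
  gives no direct information.
\<close>

lemma P_uniformly_continuous_time:
  assumes g: "g \<in> borel_measurable config_space" "\<And>\<xi>. \<bar>g \<xi>\<bar> \<le> B" and "e > 0"
  obtains d where "d > 0" "\<And>s t. 0 \<le> t \<Longrightarrow> 0 \<le> s \<Longrightarrow> s < d \<Longrightarrow> \<bar>P (t + s) g \<xi> - P t g \<xi>\<bar> < e"
proof -
  interpret prob_space "M \<xi>" by (rule prob_space_M)
  define \<iota> :: "'a multiset \<Rightarrow> real" where "\<iota> = indicator {\<xi>}"
  have \<iota>: "\<iota> \<in> borel_measurable config_space" "\<And>\<eta>. \<bar>\<iota> \<eta>\<bar> \<le> 1"
    by (auto simp: \<iota>_def singleton_in_sets_config_space indicator_def intro!: borel_measurable_indicator)
  have B0: "0 \<le> B" using g(2)[of \<xi>] by linarith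
  have key: "\<bar>P (t + s) g \<xi> - P t g \<xi>\<bar> \<le> 2 * B * (1 - P s \<iota> \<xi>)" if st: "0 \<le> t" "0 \<le> s" for s t
  proof -
    let ?h = "P t g"
    note h = P_measurable[OF st(1) g(1)] P_abs_le[OF st(1) g]
    have "P (t + s) g \<xi> - P t g \<xi> = (\<integral>\<omega>. ?h (Z \<xi> s \<omega>) - ?h \<xi> \<partial>M \<xi>)"
      using P_semigroup[OF st(2,1) g, of \<xi>] P_integrable[OF st(2) h, of \<xi>]
      by (simp add: P_def[of s] add.commute prob_space)
    also have "\<bar>\<dots>\<bar> \<le> (\<integral>\<omega>. \<bar>?h (Z \<xi> s \<omega>) - ?h \<xi>\<bar> \<partial>M \<xi>)"
      by (rule integral_abs_bound)
    also have "\<dots> \<le> (\<integral>\<omega>. 2 * B * (1 - \<iota> (Z \<xi> s \<omega>)) \<partial>M \<xi>)"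
    proof (rule integral_mono)
      show "\<bar>?h (Z \<xi> s \<omega>) - ?h \<xi>\<bar> \<le> 2 * B * (1 - \<iota> (Z \<xi> s \<omega>))" for \<omega>
        using h(2)[of \<xi>] h(2)[of "Z \<xi> s \<omega>"] by (auto simp: \<iota>_def indicator_def)
    qed (use P_integrable[OF st(2) h, of \<xi>] P_integrable[OF st(2) \<iota>, of \<xi>] in auto)
    also have "\<dots> = 2 * B * (1 - P s \<iota> \<xi>)"
      using P_integrable[OF st(2) \<iota>, of \<xi>] by (simp add: P_def prob_space)
    finally show ?thesis .
  qed
  have "((\<lambda>s. P s \<iota> \<xi>) \<longlongrightarrow> P 0 \<iota> \<xi>) (at_right 0)"
    using has_field_derivative_at_within DERIV_continuous[OF P_right_derivative[OF order_refl \<iota>, of \<xi>]]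
    by (simp add: continuous_within)
  moreover have "P 0 \<iota> \<xi> = 1" using P_0[OF \<iota>(1)] by (simp add: \<iota>_def)
  ultimately have "((\<lambda>s. 2 * B * (1 - P s \<iota> \<xi>)) \<longlongrightarrow> 2 * B * (1 - 1)) (at_right 0)"
    by (intro tendsto_intros) simp
  then have "eventually (\<lambda>s. 2 * B * (1 - P s \<iota> \<xi>) < e) (at_right 0)"
    using \<open>e > 0\<close> by (intro order_tendstoD(2)[of _ "2 * B * (1 - 1)"]) auto
  then obtain d where d: "d > 0" "\<And>s. 0 < s \<Longrightarrow> s < d \<Longrightarrow> 2 * B * (1 - P s \<iota> \<xi>) < e"
    by (auto simp: eventually_at_right_field)
  show thesis
  proof (rule that[OF d(1)])
    fix s t :: real assume "0 \<le> t" "0 \<le> s" "s < d"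
    then show "\<bar>P (t + s) g \<xi> - P t g \<xi>\<bar> < e"
      using key[of t s] d(2)[of s] \<open>e > 0\<close> by (cases "s = 0") auto
  qed
qed

lemma P_continuous_time:
  assumes g: "g \<in> borel_measurable config_space" "\<And>\<xi>. \<bar>g \<xi>\<bar> \<le> B"
  shows "continuous_on {0..} (\<lambda>t. P t g \<xi>)"
  unfolding continuous_on_iff
proof (intro ballI allI impI)
  fix t e :: real assume t: "t \<in> {0..}" "e > 0"
  obtain d where d: "d > 0" "\<And>s t. 0 \<le> t \<Longrightarrow> 0 \<le> s \<Longrightarrow> s < d \<Longrightarrow> \<bar>P (t + s) g \<xi> - P t g \<xi>\<bar> < e"
    using P_uniformly_continuous_time[OF g \<open>e > 0\<close>, of \<xi>] by metis
  have "dist (P r g \<xi>) (P t g \<xi>) < e" if r: "r \<in> {0..}" "dist r t < d" for r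
    using d(2)[of t "r - t"] d(2)[of r "t - r"] t r
    by (cases "r \<le> t") (auto simp: dist_real_def abs_minus_commute)
  then show "\<exists>d>0. \<forall>r\<in>{0..}. dist r t < d \<longrightarrow> dist (P r g \<xi>) (P t g \<xi>) < e"
    using d(1) by blast
qed

end

section \<open>Exponential ergodicity\<close>

context bd_semigroup
begin

text \<open>
  The sign \<open>sg s\<close> is part of the index because the last sum in \<open>gen_increment\<close> enters with a negative
  coefficient; it is the gain \<open>b - 1 < 0\<close> in total mass that produces the decay.
\<close>

lemma increment_decay:
  assumes g: "g \<in> borel_measurable config_space" and osc: "\<And>\<xi> \<eta>. \<bar>g \<xi> - g \<eta>\<bar> \<le> 1"
    and t: "0 \<le> t"
  shows "\<bar>P t g (add_mset x \<xi>) - P t g \<xi>\<bar> \<le> exp (- ((1 - b) * t))"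
proof -
  define B where "B = \<bar>g {#}\<bar> + 1"
  have gB: "\<bar>g \<xi>\<bar> \<le> B" for \<xi> using osc[of \<xi> "{#}"] unfolding B_def by linarith
  note PB = P_abs_le[OF _ g gB]
  define sg :: "bool \<Rightarrow> real" where "sg s = (if s then 1 else - 1)" for s
  define E where "E r = (\<lambda>(s, \<xi>, x). sg s * (P r g (add_mset x \<xi>) - P r g \<xi>))" for r
  have approx: "E t (s, \<xi>, x) \<le> exp (- ((1 - b) * t)) + \<epsilon> * (real (size \<xi>) + 1 + (a + 2) * t)"
    if \<epsilon>: "\<epsilon> > 0" for s \<xi> x \<epsilon>
  proof -
    \<comment> \<open>The exponential is the claimed bound. The \<epsilon>-part grows with
      \<open>n\<close>, so \<open>v\<close> can be positive only for sizes up to \<open>J\<close>;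
      its slope \<open>a + 2\<close> in time absorbs what the generator makes of it.\<close>
    define W where "W r n = exp (- ((1 - b) * r)) + \<epsilon> * (n + 1 + (a + 2) * r)" for r n :: real
    define v where "v r = (\<lambda>(s, \<xi>, x). E r (s, \<xi>, x) - W r (real (size \<xi>)))" for r
    define v' where "v' r = (\<lambda>(s, \<xi>, x). sg s * (gen (P r g) (add_mset x \<xi>) - gen (P r g) \<xi>) -
      (- (1 - b) * exp (- ((1 - b) * r)) + \<epsilon> * (a + 2)))" for r
    define q where "q = (\<lambda>(s::bool, \<xi>::'a multiset, x::'a). a + b * real (size \<xi>) +
      (1 + \<beta> * real (size \<xi>)) * (real (size \<xi>) + 1))"
    define J where "J = 2 * B / \<epsilon>"
    have Ebd: "E r i \<le> 2 * B" if "0 \<le> r" for r i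
      using PB[OF that, of "add_mset (snd (snd i)) (fst (snd i))"] PB[OF that, of "fst (snd i)"]
      by (auto simp: E_def sg_def split: prod.split)
    have Wpos: "\<epsilon> * n \<le> W r n" if "0 \<le> r" for r n
    proof -
      have "0 \<le> \<epsilon> * (1 + (a + 2) * r)" using \<epsilon> a_pos that by simp
      moreover have "W r n - \<epsilon> * n = exp (- ((1 - b) * r)) + \<epsilon> * (1 + (a + 2) * r)"
        unfolding W_def by (simp add: algebra_simps)
      ultimately show ?thesis using exp_gt_zero[of "- ((1 - b) * r)"] by linarith
    qed
    have "v t (s, \<xi>, x) \<le> 0"
    proof (rule parabolic_comparison[where v = v and v' = v' and q = q and T = t and B = "2 * B" and
          Q = "a + b * J + (1 + \<beta> * J) * (J + 1)"])
      show "continuous_on {0..t} (\<lambda>r. v r i)" for i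
        unfolding v_def E_def W_def
        by (cases i) (auto intro!: continuous_intros continuous_on_subset[OF P_continuous_time[OF g gB]])
      show "((\<lambda>r. v r i) has_real_derivative v' r i) (at_right r)" if "0 \<le> r" "r < t" for r i
      proof (cases i)
        case (fields s \<xi> x)
        note d = P_right_derivative[OF \<open>0 \<le> r\<close> g gB]
        show ?thesis unfolding v_def v'_def E_def W_def fields
          by (auto intro!: derivative_eq_intros d)
      qed
      show "v 0 i \<le> 0" for i
      proof (cases i)
        case (fields s \<xi> x)
        have "0 \<le> \<epsilon> * (real (size \<xi>) + 1)" using \<epsilon> by simp
        then show ?thesis
          using osc[of "add_mset x \<xi>" \<xi>] unfolding v_def E_def W_def fields
          by (auto simp: P_0[OF g] sg_def)
      qed
      show "v r i \<le> 2 * B" if "0 \<le> r" "r \<le> t" for r i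
      proof (cases i)
        case (fields s \<xi> x)
        have "0 \<le> \<epsilon> * real (size \<xi>)" using \<epsilon> by simp
        then show ?thesis
          using Ebd[OF that(1), of i] Wpos[OF that(1), of "real (size \<xi>)"] by (simp add: v_def fields)
      qed
      show "q i \<le> a + b * J + (1 + \<beta> * J) * (J + 1)" if "0 \<le> r" "r \<le> t" "0 < v r i" for r i
      proof (cases i)
        case (fields s \<xi> x)
        have "\<epsilon> * real (size \<xi>) \<le> 2 * B"
          using Ebd[OF that(1), of i] Wpos[OF that(1), of "real (size \<xi>)"] that(3)
          by (auto simp: v_def fields)
        then have "real (size \<xi>) \<le> J" using \<epsilon> by (simp add: J_def field_simps)
        then show ?thesis
          unfolding fields q_def using b_nonneg \<beta>_nonneg
          by (auto intro!: add_mono mult_mono)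
      qed
      fix i r m assume r: "0 \<le> r" "r < t" and m: "0 \<le> m" "\<And>j. v r j \<le> m"
      show "v' r i \<le> q i * (m - v r i)"
      proof (cases i)
        case (fields s \<xi> x)
        let ?u = "P r g"
        let ?n = "real (size \<xi>)"
        define e where "e \<xi> x = P r g (add_mset x \<xi>) - P r g \<xi>" for \<xi> x
        have le: "sg s * e \<xi> x \<le> m + W r (real (size \<xi>))" for s \<xi> x
          using m(2)[of "(s, \<xi>, x)"] by (simp add: v_def E_def e_def)
        note um = P_measurable[OF r(1) g] PB[OF r(1)]
        have int: "integrable \<mu> (\<lambda>x. ?u (add_mset x \<xi>))" for \<xi>
          by (rule integrable_add_mset[OF um])
        have inte: "integrable \<mu> (\<lambda>z. e \<xi> z)" "integrable \<mu> (\<lambda>z. e (add_mset z \<xi>) x)" for \<xi> x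
          using int[of \<xi>] int[of "add_mset x \<xi>"] by (auto simp: e_def add_mset_commute)
        let ?e = "sg s * e \<xi> x"
        have 1: "sg s * (\<integral>z. e (add_mset x \<xi>) z \<partial>\<mu>) \<le> m + W r (?n + 1)"
        proof -
          have "(\<integral>z. sg s * e (add_mset x \<xi>) z \<partial>\<mu>) \<le> (\<integral>z. m + W r (?n + 1) \<partial>\<mu>)"
            using le[of s "add_mset x \<xi>"] inte by (intro integral_mono) (auto simp: add.commute)
          then show ?thesis by (simp add: \<mu>.prob_space)
        qed
        have 2: "sg s * (\<integral>z. (e (add_mset z \<xi>) x - e \<xi> x) \<partial>\<mu>) \<le> m + W r (?n + 1) - ?e"
        proof -
          have "(\<integral>z. sg s * (e (add_mset z \<xi>) x - e \<xi> x) \<partial>\<mu>) \<le> (\<integral>z. m + W r (?n + 1) - ?e \<partial>\<mu>)"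
            using le[of s "add_mset _ \<xi>" x] inte
            by (intro integral_mono) (auto simp: add.commute right_diff_distrib)
          then show ?thesis by (simp add: \<mu>.prob_space)
        qed
        have 3: "sg s * (\<Sum>w\<in>#\<xi>. (e (\<xi> - {#w#}) x - e \<xi> x)) \<le> ?n * (m + W r (?n - 1) - ?e)"
          unfolding sum_mset_distrib_left
        proof (rule sum_mset_le)
          fix w assume "w \<in># \<xi>"
          then show "sg s * (e (\<xi> - {#w#}) x - e \<xi> x) \<le> m + W r (?n - 1) - ?e"
            using le[of s "\<xi> - {#w#}" x] size_remove_real[of w \<xi>] by (simp add: right_diff_distrib)
        qed
        have 4: "- (sg s * (\<Sum>w\<in>#\<xi>. e (\<xi> - {#w#}) w)) \<le> ?n * (m + W r (?n - 1))"
        proof -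
          have "- (sg s * (\<Sum>w\<in>#\<xi>. e (\<xi> - {#w#}) w)) = (\<Sum>w\<in>#\<xi>. sg (\<not> s) * e (\<xi> - {#w#}) w)"
            by (simp add: sg_def sum_mset_distrib_left[symmetric])
          also have "\<dots> \<le> ?n * (m + W r (?n - 1))"
          proof (rule sum_mset_le)
            fix w assume "w \<in># \<xi>"
            then show "sg (\<not> s) * e (\<xi> - {#w#}) w \<le> m + W r (?n - 1)"
              using le[of "\<not> s" "\<xi> - {#w#}" w] size_remove_real[of w \<xi>] by simp
          qed
          finally show ?thesis .
        qed
        have "sg s * (gen ?u (add_mset x \<xi>) - gen ?u \<xi>) =
            b * (sg s * (\<integral>z. e (add_mset x \<xi>) z \<partial>\<mu>)) +
            (a + b * ?n) * (sg s * (\<integral>z. (e (add_mset z \<xi>) x - e \<xi> x) \<partial>\<mu>)) +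
            (1 + \<beta> * ?n) * (sg s * (\<Sum>w\<in>#\<xi>. (e (\<xi> - {#w#}) x - e \<xi> x)) - ?e) +
            \<beta> * (- (sg s * (\<Sum>w\<in>#\<xi>. e (\<xi> - {#w#}) w)))"
          unfolding e_def gen_increment[OF int] by (simp add: algebra_simps)
        also have "\<dots> \<le> b * (m + W r (?n + 1)) + (a + b * ?n) * (m + W r (?n + 1) - ?e) +
            (1 + \<beta> * ?n) * (?n * (m + W r (?n - 1) - ?e) - ?e) + \<beta> * (?n * (m + W r (?n - 1)))"
          using a_pos b_nonneg \<beta>_nonneg
          by (intro add_mono mult_left_mono 1 2 3 4 diff_right_mono) auto
        finally have main: "v' r i \<le> b * (m + W r (?n + 1)) + (a + b * ?n) * (m + W r (?n + 1) - ?e) +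
            (1 + \<beta> * ?n) * (?n * (m + W r (?n - 1) - ?e) - ?e) + \<beta> * (?n * (m + W r (?n - 1))) -
            (- (1 - b) * exp (- ((1 - b) * r)) + \<epsilon> * (a + 2))"
          by (simp add: v'_def fields)
        have ev: "?e = v r i + W r ?n" by (simp add: v_def E_def e_def fields)
        define p where "p = exp (- ((1 - b) * r)) + \<epsilon> * ((a + 2) * r)"
        have Wp: "W r n = p + \<epsilon> * (n + 1)" for n by (simp add: W_def p_def algebra_simps)
        have W: "b * W r (?n + 1) + (a + b * ?n) * (W r (?n + 1) - W r ?n) +
            (1 + \<beta> * ?n) * (?n * (W r (?n - 1) - W r ?n) - W r ?n) + \<beta> * (?n * W r (?n - 1)) =
            - (1 - b) * p + \<epsilon> * (a + 2 * b - 1 - 2 * (1 - b) * ?n - \<beta> * ?n * (?n + 1))"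
          unfolding Wp by (simp add: algebra_simps)
        have "(1 - b) * exp (- ((1 - b) * r)) \<le> (1 - b) * p"
          unfolding p_def using b_less \<epsilon> a_pos r by (intro mult_left_mono) auto
        moreover have "\<epsilon> * (a + 2 * b - 1 - 2 * (1 - b) * ?n - \<beta> * ?n * (?n + 1)) \<le> \<epsilon> * (a + 2)"
        proof (intro mult_left_mono)
          have "0 \<le> 2 * (1 - b) * ?n" "0 \<le> \<beta> * ?n * (?n + 1)" using b_less \<beta>_nonneg by auto
          then show "a + 2 * b - 1 - 2 * (1 - b) * ?n - \<beta> * ?n * (?n + 1) \<le> a + 2"
            using b_less by linarith
        qed (use \<epsilon> in simp)
        moreover have "(b - 1) * m \<le> 0" using b_less m(1) by (intro mult_nonpos_nonneg) auto
        \<comment> \<open>The coefficient of \<open>m\<close> decides the decay: the extra births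
          and deaths contribute \<open>b + \<beta> * n\<close>, while the death of the additional
          particle takes away \<open>1 + \<beta> * n\<close>. The balance is
          \<open>b - 1\<close>.\<close>
        moreover have "b * (m + W r (?n + 1)) + (a + b * ?n) * (m + W r (?n + 1) - ?e) +
            (1 + \<beta> * ?n) * (?n * (m + W r (?n - 1) - ?e) - ?e) + \<beta> * (?n * (m + W r (?n - 1))) =
            q i * (m - v r i) + (b - 1) * m +
            (b * W r (?n + 1) + (a + b * ?n) * (W r (?n + 1) - W r ?n) +
            (1 + \<beta> * ?n) * (?n * (W r (?n - 1) - W r ?n) - W r ?n) + \<beta> * (?n * W r (?n - 1)))"
          unfolding ev fields q_def by (simp add: algebra_simps)
        ultimately show ?thesis using main unfolding W by linarith
      qed
    qed (use t in auto)
    then show ?thesis by (simp add: v_def W_def)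
  qed
  have "E t (s, \<xi>, x) \<le> exp (- ((1 - b) * t))" for s
  proof (rule field_le_epsilon)
    fix \<delta> :: real assume "\<delta> > 0"
    define k where "k = real (size \<xi>) + 1 + (a + 2) * t"
    have "0 \<le> (a + 2) * t" using a_pos t by simp
    then have "k > 0" unfolding k_def by linarith
    then show "E t (s, \<xi>, x) \<le> exp (- ((1 - b) * t)) + \<delta>"
      using approx[of "\<delta> / k" s \<xi> x] \<open>\<delta> > 0\<close> by (simp add: k_def)
  qed
  from this[of True] this[of False] show ?thesis by (auto simp: E_def sg_def)
qed

text \<open>Since \<open>\<alpha>_n - d_n \<le> a - (1 - b) * n\<close>, the mean size is dominated
  by the solution of y' = a - (1 - b) y started at \<open>size \<xi>\<close>, which is the right
  side. Truncation at \<open>N\<close> keeps the function bounded, and the bound does not depend on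
  \<open>N\<close>.\<close>

lemma truncated_size_moment:
  assumes t: "0 \<le> t"
  shows "P t (\<lambda>\<xi>. min (real (size \<xi>)) N) \<xi> \<le>
    exp (- ((1 - b) * t)) * real (size \<xi>) + a / (1 - b) * (1 - exp (- ((1 - b) * t)))"
    (is "P t ?g \<xi> \<le> _")
proof -
  have g: "?g \<in> borel_measurable config_space"
    using measurable_compose[OF measurable_size_config, of "\<lambda>n. min (real n) N" borel] by simp
  have gB: "\<bar>?g \<xi>\<bar> \<le> \<bar>N\<bar>" for \<xi> by auto
  note PB = P_abs_le[OF _ g gB]
  define c where "c = 1 - b"
  have c: "c > 0" using b_less by (simp add: c_def)
  define W where "W r n = exp (- (c * r)) * n + a / c * (1 - exp (- (c * r)))" for r n :: real
  define v where "v r \<xi> = P r ?g \<xi> - W r (real (size \<xi>))" for r and \<xi> :: "'a multiset"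
  define v' where "v' r \<xi> = gen (P r ?g) \<xi> - (- c * exp (- (c * r)) * real (size \<xi>) + a * exp (- (c * r)))"
    for r and \<xi> :: "'a multiset"
  define q where "q \<xi> = a + b * real (size \<xi>) + real (size \<xi>) * (1 + \<beta> * (real (size \<xi>) - 1))"
    for \<xi> :: "'a multiset"
  \<comment> \<open>The supersolution itself confines here: \<open>v > 0\<close> forces
    \<open>exp (- (c * t)) * size \<xi> \<le> \<bar>N\<bar>\<close>.\<close>
  define J where "J = \<bar>N\<bar> * exp (c * t)"
  have Wpos: "exp (- (c * r)) * n \<le> W r n" if "0 \<le> r" for r n
    unfolding W_def using c a_pos that by simp
  have "v t \<xi> \<le> 0"
  proof (rule parabolic_comparison[where v = v and v' = v' and q = q and T = t and B = "\<bar>N\<bar>" and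
        Q = "a + b * J + J * (1 + \<beta> * J)"])
    show "continuous_on {0..t} (\<lambda>r. v r i)" for i
      unfolding v_def W_def using c
      by (auto intro!: continuous_intros continuous_on_subset[OF P_continuous_time[OF g gB]])
    show "((\<lambda>r. v r i) has_real_derivative v' r i) (at_right r)" if "0 \<le> r" "r < t" for r i
      unfolding v_def v'_def W_def using c
      by (auto intro!: derivative_eq_intros P_right_derivative[OF \<open>0 \<le> r\<close> g gB])
    show "v 0 i \<le> 0" for i
      by (simp add: v_def W_def P_0[OF g])
    show "v r i \<le> \<bar>N\<bar>" if "0 \<le> r" "r \<le> t" for r i
    proof -
      have "0 \<le> exp (- (c * r)) * real (size i)" by simp
      then show ?thesis
        using PB[OF that(1), of i] Wpos[OF that(1), of "real (size i)"] unfolding v_def by linarith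
    qed
    show "q i \<le> a + b * J + J * (1 + \<beta> * J)" if "0 \<le> r" "r \<le> t" "0 < v r i" for r i
    proof -
      have "exp (- (c * t)) * real (size i) \<le> exp (- (c * r)) * real (size i)"
        using c that by (intro mult_right_mono) auto
      also have "\<dots> \<le> \<bar>N\<bar>"
        using PB[OF that(1), of i] Wpos[OF that(1), of "real (size i)"] that(3) unfolding v_def by linarith
      finally have J: "real (size i) \<le> J" by (simp add: J_def exp_minus field_simps)
      have "1 + \<beta> * (real (size i) - 1) \<le> 1 + \<beta> * J"
        using J \<beta>_nonneg by (intro add_mono mult_left_mono) auto
      then have "real (size i) * (1 + \<beta> * (real (size i) - 1)) \<le> real (size i) * (1 + \<beta> * J)"
        by (intro mult_left_mono) auto
      also have "\<dots> \<le> J * (1 + \<beta> * J)"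
        using J \<beta>_nonneg by (intro mult_right_mono) (auto intro: order_trans)
      finally show ?thesis unfolding q_def using J b_nonneg by (auto intro!: add_mono mult_left_mono)
    qed
    fix i :: "'a multiset" and r m assume r: "0 \<le> r" "r < t" and m: "0 \<le> m" "\<And>j. v r j \<le> m"
    let ?u = "P r ?g"
    let ?n = "real (size i)"
    have le: "?u \<xi> \<le> m + W r (real (size \<xi>))" for \<xi> using m(2)[of \<xi>] by (simp add: v_def)
    have "gen ?u i \<le> (a + b * ?n) * (m + W r (?n + 1) - ?u i) +
        ?n * (1 + \<beta> * (?n - 1)) * (m + W r (?n - 1) - ?u i)"
    proof (rule gen_le)
      show "integrable \<mu> (\<lambda>x. ?u (add_mset x i))"
        by (rule integrable_add_mset[OF P_measurable[OF r(1) g] PB[OF r(1)]])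
      show "?u (add_mset x i) \<le> m + W r (?n + 1)" for x using le[of "add_mset x i"] by (simp add: add.commute)
      show "?u (i - {#w#}) \<le> m + W r (?n - 1)" if "w \<in># i" for w
        using le[of "i - {#w#}"] size_remove_real[OF that] by simp
    qed
    also have "\<dots> = q i * (m - v r i) + exp (- (c * r)) * (a + b * ?n - ?n * (1 + \<beta> * (?n - 1)))"
      unfolding q_def v_def W_def by (simp add: algebra_simps add_divide_distrib)
    also have "exp (- (c * r)) * (a + b * ?n - ?n * (1 + \<beta> * (?n - 1))) \<le> exp (- (c * r)) * (a - c * ?n)"
    proof (rule mult_left_mono)
      have "0 \<le> \<beta> * (?n * (?n - 1))" using \<beta>_nonneg by (cases "size i") auto
      then show "a + b * ?n - ?n * (1 + \<beta> * (?n - 1)) \<le> a - c * ?n"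
        unfolding c_def by (simp add: algebra_simps)
    qed simp
    finally show "v' r i \<le> q i * (m - v r i)"
      unfolding v'_def by (simp add: algebra_simps)
  qed (use t in auto)
  then show ?thesis unfolding v_def W_def c_def by (simp add: algebra_simps)
qed

end

section \<open>Moments of the invariant distribution and convergence to it\<close>

locale bd_stationary = bd_semigroup a b \<beta> \<mu> M Z
  for a b \<beta> :: real and \<mu> :: "'a::metric_space measure"
    and M :: "'a multiset \<Rightarrow> 'w measure" and Z :: "'a multiset \<Rightarrow> real \<Rightarrow> 'w \<Rightarrow> 'a multiset" +
  fixes \<pi> :: "'a multiset measure"
  assumes invariant: "invariant_distribution M Z \<pi>"
begin

sublocale \<pi>: prob_space \<pi>
  using invariant by (simp add: invariant_distribution_def)

lemma sets_\<pi>: "sets \<pi> = sets config_space"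
  using invariant by (simp add: invariant_distribution_def)

lemma measurable_\<pi>_eq: "\<pi> \<rightarrow>\<^sub>M N = config_space \<rightarrow>\<^sub>M N"
  by (rule measurable_cong_sets[OF sets_\<pi> refl])

lemma \<pi>_integrable:
  fixes g :: "'a multiset \<Rightarrow> real"
  assumes "g \<in> borel_measurable config_space" "\<And>\<xi>. \<bar>g \<xi>\<bar> \<le> B"
  shows "integrable \<pi> g"
  using assms by (intro \<pi>.integrable_const_bound[of _ B]) (auto simp: measurable_\<pi>_eq)

lemma \<pi>_P:
  assumes t: "0 \<le> t" and g: "g \<in> borel_measurable config_space" "\<And>\<xi>. \<bar>g \<xi>\<bar> \<le> B"
  shows "(\<integral>\<eta>. P t g \<eta> \<partial>\<pi>) = (\<integral>\<eta>. g \<eta> \<partial>\<pi>)"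
proof -
  note K = kernel[OF t]
  have "(\<integral>\<eta>. g \<eta> \<partial>\<pi>) = integral\<^sup>L (bind \<pi> (transition M Z t)) g"
    using invariant t by (simp add: invariant_distribution_def)
  also have "\<dots> = (\<integral>\<xi>. integral\<^sup>L (transition M Z t \<xi>) g \<partial>\<pi>)"
  proof (rule integral_bind[where K = config_space and B = B and B' = 1])
    show "transition M Z t \<in> \<pi> \<rightarrow>\<^sub>M subprob_algebra config_space"
      unfolding measurable_\<pi>_eq by (rule measurable_prob_algebraD[OF K])
    have "prob_space (transition M Z t \<xi>)" for \<xi>
      using measurable_space[OF K, of \<xi>] by (simp add: space_prob_algebra)
    then show "AE \<xi> in \<pi>. emeasure (transition M Z t \<xi>) (space (transition M Z t \<xi>)) \<le> ennreal 1"
      by (simp add: prob_space.emeasure_space_1)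
  qed (use g \<pi>.finite_measure_axioms in auto)
  finally show ?thesis by (simp add: P_eq_transition[OF t g(1)])
qed

text \<open>By invariance the truncated moment equals its value after time \<open>k\<close>. Letting
  \<open>k\<close> tend to infinity for fixed \<open>N\<close> removes the contribution of the
  initial size and leaves \<open>a / (1 - b)\<close>; monotone convergence in \<open>N\<close>
  follows.\<close>

lemma \<pi>_size:
  "integrable \<pi> (\<lambda>\<eta>. real (size \<eta>))" "(\<integral>\<eta>. real (size \<eta>) \<partial>\<pi>) \<le> a / (1 - b)"
proof -
  define K where "K = a / (1 - b)"
  have K0: "0 \<le> K" using a_pos b_less by (simp add: K_def)
  have ms [measurable]: "(\<lambda>\<eta>. real (size \<eta>)) \<in> borel_measurable \<pi>"
    unfolding measurable_\<pi>_eq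
    using measurable_compose[OF measurable_size_config, of real borel] by simp
  have trunc: "(\<integral>\<eta>. min (real (size \<eta>)) (real N) \<partial>\<pi>) \<le> K" for N :: nat
  proof -
    let ?g = "\<lambda>\<eta> :: 'a multiset. min (real (size \<eta>)) (real N)"
    have g: "?g \<in> borel_measurable config_space" "\<And>\<xi>. \<bar>?g \<xi>\<bar> \<le> real N"
      using ms unfolding measurable_\<pi>_eq by (auto intro!: borel_measurable_min)
    \<comment> \<open>The initial-size term is truncated as well, so that dominated convergence
      applies before any moment of \<pi> is known to be finite.\<close>
    let ?s = "\<lambda>k \<eta> :: 'a multiset. min (exp (- ((1 - b) * real k)) * real (size \<eta>)) (real N)"
    have le: "(\<integral>\<eta>. ?g \<eta> \<partial>\<pi>) \<le> (\<integral>\<eta>. ?s k \<eta> \<partial>\<pi>) + K" for k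
    proof -
      have si: "integrable \<pi> (?s k)"
        using ms by (intro \<pi>.integrable_const_bound[of _ "real N"]) auto
      have "(\<integral>\<eta>. ?g \<eta> \<partial>\<pi>) = (\<integral>\<eta>. P (real k) ?g \<eta> \<partial>\<pi>)"
        by (rule \<pi>_P[symmetric, OF _ g]) simp
      also have "\<dots> \<le> (\<integral>\<eta>. ?s k \<eta> + K \<partial>\<pi>)"
      proof (rule integral_mono)
        show "integrable \<pi> (P (real k) ?g)"
          by (rule \<pi>_integrable[OF P_measurable P_abs_le, OF _ g(1) _ g]) auto
        fix \<eta> :: "'a multiset"
        let ?x = "exp (- ((1 - b) * real k))"
        have "K * (1 - ?x) \<le> K * 1" using K0 by (intro mult_left_mono) auto
        then show "P (real k) ?g \<eta> \<le> ?s k \<eta> + K"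
          using truncated_size_moment[of "real k" "real N" \<eta>] K0
            P_abs_le[OF _ g, of "real k" \<eta>] by (auto simp: K_def[symmetric] min_def)
      qed (use si in auto)
      also have "\<dots> = (\<integral>\<eta>. ?s k \<eta> \<partial>\<pi>) + K" using si by (simp add: \<pi>.prob_space)
      finally show ?thesis .
    qed
    have "(\<lambda>k. \<integral>\<eta>. ?s k \<eta> \<partial>\<pi>) \<longlonglongrightarrow> (\<integral>\<eta>. 0 \<partial>\<pi>)"
    proof (rule integral_dominated_convergence[where w = "\<lambda>_. real N"])
      have "(\<lambda>k. exp (- ((1 - b) * real k))) \<longlonglongrightarrow> 0"
        using b_less by real_asymp
      then have "(\<lambda>k. ?s k \<eta>) \<longlonglongrightarrow> min (0 * real (size \<eta>)) (real N)" for \<eta> :: "'a multiset"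
        by (intro tendsto_intros)
      then show "AE \<eta> in \<pi>. (\<lambda>k. ?s k \<eta>) \<longlonglongrightarrow> 0" by simp
    qed (use ms in auto)
    then have "(\<lambda>k. (\<integral>\<eta>. ?s k \<eta> \<partial>\<pi>) + K) \<longlonglongrightarrow> 0 + K" by (intro tendsto_intros) simp
    then show ?thesis using le by (intro LIMSEQ_le_const[of _ K]) auto
  qed
  have lim: "(\<lambda>N. min (real (size \<eta>)) (real N)) \<longlonglongrightarrow> real (size \<eta>)" for \<eta> :: "'a multiset"
    by (rule tendsto_eventually) (auto simp: eventually_sequentially intro!: exI[of _ "size \<eta>"])
  have mono: "mono (\<lambda>N. min (real (size \<eta>)) (real N))" for \<eta> :: "'a multiset"
    by (auto simp: mono_def)
  have ti: "integrable \<pi> (\<lambda>\<eta>. min (real (size \<eta>)) (real N))" for N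
    using ms by (intro \<pi>.integrable_const_bound[of _ "real N"]) auto
  have im: "incseq (\<lambda>N. \<integral>\<eta>. min (real (size \<eta>)) (real N) \<partial>\<pi>)"
    unfolding incseq_def by (intro allI impI integral_mono ti) auto
  obtain l where l: "(\<lambda>N. \<integral>\<eta>. min (real (size \<eta>)) (real N) \<partial>\<pi>) \<longlonglongrightarrow> l"
    using incseq_convergent[OF im, of K] trunc by blast
  show "integrable \<pi> (\<lambda>\<eta>. real (size \<eta>))"
    by (rule integrable_monotone_convergence[OF ti _ _ l]) (use mono lim in auto)
  have "(\<integral>\<eta>. real (size \<eta>) \<partial>\<pi>) = l"
    by (rule integral_monotone_convergence[OF ti _ _ l]) (use mono lim in auto)
  also have "l \<le> K" using trunc by (intro LIMSEQ_le_const2[OF l]) auto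
  finally show "(\<integral>\<eta>. real (size \<eta>) \<partial>\<pi>) \<le> a / (1 - b)" by (simp add: K_def)
qed

text \<open>Both configurations are compared with the empty one, adding particles one at a
  time.\<close>

lemma P_diff_decay:
  assumes g: "g \<in> borel_measurable config_space" and osc: "\<And>\<xi> \<eta>. \<bar>g \<xi> - g \<eta>\<bar> \<le> 1" and t: "0 \<le> t"
  shows "\<bar>P t g \<xi> - P t g \<eta>\<bar> \<le> exp (- ((1 - b) * t)) * (real (size \<xi>) + real (size \<eta>))"
proof -
  have "\<bar>P t g \<xi> - P t g {#}\<bar> \<le> exp (- ((1 - b) * t)) * real (size \<xi>)" for \<xi>
  proof (induction \<xi>)
    case (add x \<xi>)
    then show ?case using increment_decay[OF g osc t, of x \<xi>] by (simp add: algebra_simps)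
  qed simp
  from this[of \<xi>] this[of \<eta>] show ?thesis unfolding distrib_left by linarith
qed

lemma P_exponential_ergodicity:
  assumes g: "g \<in> borel_measurable config_space" and osc: "\<And>\<xi> \<eta>. \<bar>g \<xi> - g \<eta>\<bar> \<le> 1" and t: "0 \<le> t"
  shows "\<bar>P t g \<xi> - (\<integral>\<eta>. g \<eta> \<partial>\<pi>)\<bar> \<le> exp (- ((1 - b) * t)) * (real (size \<xi>) + a / (1 - b))"
proof -
  have gB: "\<bar>g \<xi>\<bar> \<le> \<bar>g {#}\<bar> + 1" for \<xi> using osc[of \<xi> "{#}"] by linarith
  have i: "integrable \<pi> (P t g)"
    by (rule \<pi>_integrable[OF P_measurable[OF t g] P_abs_le[OF t g gB]])
  have "P t g \<xi> - (\<integral>\<eta>. g \<eta> \<partial>\<pi>) = (\<integral>\<eta>. (P t g \<xi> - P t g \<eta>) \<partial>\<pi>)"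
    using i by (simp add: \<pi>_P[OF t g gB] \<pi>.prob_space)
  also have "\<bar>\<dots>\<bar> \<le> (\<integral>\<eta>. \<bar>P t g \<xi> - P t g \<eta>\<bar> \<partial>\<pi>)" by (rule integral_abs_bound)
  also have "\<dots> \<le> (\<integral>\<eta>. exp (- ((1 - b) * t)) * (real (size \<xi>) + real (size \<eta>)) \<partial>\<pi>)"
    using i \<pi>_size(1) by (intro integral_mono P_diff_decay g osc t) auto
  also have "\<dots> = exp (- ((1 - b) * t)) * (real (size \<xi>) + (\<integral>\<eta>. real (size \<eta>) \<partial>\<pi>))"
    using \<pi>_size(1) by (simp add: \<pi>.prob_space)
  also have "\<dots> \<le> exp (- ((1 - b) * t)) * (real (size \<xi>) + a / (1 - b))"
    using \<pi>_size(2) by (intro mult_left_mono add_left_mono) auto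
  finally show ?thesis .
qed

end

section \<open>The Poisson equation\<close>

lemma continuous_on_sum_mset:
  fixes f :: "'b::topological_space \<Rightarrow> 'a \<Rightarrow> real"
  assumes "\<And>w. continuous_on S (\<lambda>t. f t w)"
  shows "continuous_on S (\<lambda>t. \<Sum>w\<in>#A. f t w)"
  by (induction A) (auto intro!: continuous_intros assms)

lemma has_bochner_integral_sum_mset:
  fixes f :: "'b \<Rightarrow> 'a \<Rightarrow> real"
  assumes "\<And>w. w \<in># A \<Longrightarrow> has_bochner_integral N (\<lambda>t. f t w) (F w)"
  shows "has_bochner_integral N (\<lambda>t. \<Sum>w\<in>#A. f t w) (\<Sum>w\<in>#A. F w)"
  using assms by (induction A) (auto intro!: has_bochner_integral_add has_bochner_integral_zero)

context bd_stationary
begin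

lemma integrable_exp_decay: "integrable lborel (\<lambda>t. indicator {0..} t * exp (- ((1 - b) * t)) :: real)"
proof (rule integrableI_nonneg)
  have "(\<integral>\<^sup>+t. ennreal (exp (- ((1 - b) * t))) * indicator {0..} t \<partial>lborel) =
      ennreal (0 - (- exp (- ((1 - b) * 0)) / (1 - b)))"
  proof (rule nn_integral_FTC_atLeast[where F = "\<lambda>t. - exp (- ((1 - b) * t)) / (1 - b)"])
    show "((\<lambda>t. - exp (- ((1 - b) * t)) / (1 - b)) \<longlongrightarrow> 0) at_top"
      using b_less by real_asymp
    show "((\<lambda>t. - exp (- ((1 - b) * t)) / (1 - b)) has_real_derivative exp (- ((1 - b) * t))) (at t)" for t
    proof -
      obtain c where c: "1 - b = c" "c > 0" using b_less by simp
      show ?thesis unfolding c(1) using c(2) by (auto intro!: derivative_eq_intros)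
    qed
  qed auto
  also have "(\<integral>\<^sup>+t. ennreal (exp (- ((1 - b) * t))) * indicator {0..} t \<partial>lborel) =
      (\<integral>\<^sup>+t. ennreal (indicator {0..} t * exp (- ((1 - b) * t))) \<partial>lborel)"
    by (intro nn_integral_cong) (auto simp: indicator_def)
  finally show "(\<integral>\<^sup>+t. ennreal (indicator {0..} t * exp (- ((1 - b) * t))) \<partial>lborel) < \<infinity>"
    by simp
qed (auto simp: indicator_def)

definition decay_mass :: real where
  "decay_mass = (\<integral>t. indicator {0..} t * exp (- ((1 - b) * t)) \<partial>lborel)"

end

locale bd_observable = bd_stationary a b \<beta> \<mu> M Z \<pi>
  for a b \<beta> :: real and \<mu> :: "'a::metric_space measure"
    and M :: "'a multiset \<Rightarrow> 'w measure" and Z :: "'a multiset \<Rightarrow> real \<Rightarrow> 'w \<Rightarrow> 'a multiset"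
    and \<pi> :: "'a multiset measure" +
  fixes g :: "'a multiset \<Rightarrow> real"
  assumes g_meas: "g \<in> borel_measurable config_space"
    and g_osc: "\<And>\<xi> \<eta>. \<bar>g \<xi> - g \<eta>\<bar> \<le> 1"
begin

lemma g_bound: "\<bar>g \<xi>\<bar> \<le> \<bar>g {#}\<bar> + 1"
  using g_osc[of \<xi> "{#}"] by linarith

text \<open>Freezing \<open>t\<close> at 0 for negative times gives a function that is continuous on
  the whole line.\<close>

definition u :: "real \<Rightarrow> 'a multiset \<Rightarrow> real" where
  "u t = P (max 0 t) g"

definition mean :: real where "mean = (\<integral>\<eta>. g \<eta> \<partial>\<pi>)"

definition excess :: "'a multiset \<Rightarrow> real \<Rightarrow> real" where
  "excess \<xi> t = indicator {0..} t * (u t \<xi> - mean)"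

definition h :: "'a multiset \<Rightarrow> real" where
  "h \<xi> = - (\<integral>t. excess \<xi> t \<partial>lborel)"

lemma h_eq_stein_solution: "h = stein_solution M Z \<pi> g"
proof
  fix \<xi>
  have "(\<integral>t. excess \<xi> t \<partial>lborel) =
      (LBINT t:{0..}. ((\<integral>\<omega>. g (Z \<xi> t \<omega>) \<partial>M \<xi>) - (\<integral>\<eta>. g \<eta> \<partial>\<pi>)))"
    unfolding set_lebesgue_integral_def
    by (intro Bochner_Integration.integral_cong) (auto simp: excess_def u_def P_def mean_def indicator_def)
  then show "h \<xi> = stein_solution M Z \<pi> g \<xi>" by (simp add: h_def stein_solution_def)
qed

lemma u_measurable: "u t \<in> borel_measurable config_space"
  unfolding u_def by (intro P_measurable g_meas) simp

lemma u_bound: "\<bar>u t \<xi>\<bar> \<le> \<bar>g {#}\<bar> + 1"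
  unfolding u_def by (intro P_abs_le g_meas g_bound) simp

lemma u_integrable: "integrable \<mu> (\<lambda>x. u t (add_mset x \<xi>))"
  by (rule integrable_add_mset[OF u_measurable u_bound])

lemma u_continuous: "continuous_on UNIV (\<lambda>t. u t \<xi>)"
  unfolding u_def
  by (rule continuous_on_compose2[OF P_continuous_time[OF g_meas g_bound]]) (auto intro!: continuous_intros)

lemma u_measurable_time: "(\<lambda>t. u t \<xi>) \<in> borel_measurable borel"
  by (rule borel_measurable_continuous_onI[OF u_continuous])

text \<open>A function continuous in \<open>t\<close> and measurable in \<open>x\<close> is jointly
  measurable: rounding \<open>t\<close> up to a grid of width \<open>1 / (n + 1)\<close> leaves
  countably many time slices, and continuity recovers the limit.\<close>

lemma u_joint_measurable: "(\<lambda>(t, x). u t (add_mset x \<xi>)) \<in> borel_measurable (lborel \<Otimes>\<^sub>M \<mu>)"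
proof (rule borel_measurable_LIMSEQ_real)
  define \<tau> where "\<tau> n t = of_int \<lceil>t * real (Suc n)\<rceil> / real (Suc n)" for n and t :: real
  have \<tau>: "(\<lambda>n. \<tau> n t) \<longlonglongrightarrow> t" for t
  proof (rule LIM_zero_cancel, rule Lim_null_comparison[OF _ LIMSEQ_Suc[OF lim_1_over_n]])
    have "\<bar>\<tau> n t - t\<bar> \<le> 1 / real (Suc n)" for n
    proof -
      have "\<tau> n t - t = (of_int \<lceil>t * real (Suc n)\<rceil> - t * real (Suc n)) / real (Suc n)"
        by (simp add: \<tau>_def diff_divide_distrib del: of_nat_Suc)
      moreover have "\<bar>of_int \<lceil>t * real (Suc n)\<rceil> - t * real (Suc n)\<bar> \<le> 1" by linarith
      ultimately show ?thesis by (simp add: divide_right_mono del: of_nat_Suc)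
    qed
    then show "\<forall>\<^sub>F n in sequentially. norm (\<tau> n t - t) \<le> 1 / of_nat (Suc n)" by simp
  qed
  show "(\<lambda>n. case p of (t, x) \<Rightarrow> u (\<tau> n t) (add_mset x \<xi>)) \<longlonglongrightarrow> (case p of (t, x) \<Rightarrow> u t (add_mset x \<xi>))" for p
    by (auto split: prod.split intro!: continuous_on_tendsto_compose[OF u_continuous \<tau>])
  fix n
  have "(\<lambda>p. u (of_int k / real (Suc n)) (add_mset (snd p) \<xi>)) \<in> borel_measurable (lborel \<Otimes>\<^sub>M \<mu>)" for k :: int
  proof -
    have "(\<lambda>x. u (of_int k / real (Suc n)) (add_mset x \<xi>)) \<in> borel_measurable \<mu>"
      unfolding measurable_\<mu>_eq by (rule measurable_compose[OF measurable_add_mset_config u_measurable])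
    then show ?thesis by measurable
  qed
  moreover have "(\<lambda>p. \<lceil>fst p * real (Suc n)\<rceil>) \<in> lborel \<Otimes>\<^sub>M \<mu> \<rightarrow>\<^sub>M count_space UNIV"
    by measurable
  ultimately have "(\<lambda>p. u (of_int \<lceil>fst p * real (Suc n)\<rceil> / real (Suc n)) (add_mset (snd p) \<xi>)) \<in>
      borel_measurable (lborel \<Otimes>\<^sub>M \<mu>)"
    by (rule measurable_compose_countable)
  then show "(\<lambda>p. case p of (t, x) \<Rightarrow> u (\<tau> n t) (add_mset x \<xi>)) \<in> borel_measurable (lborel \<Otimes>\<^sub>M \<mu>)"
    by (simp add: \<tau>_def case_prod_beta)
qed

lemma u_increment_decay: "0 \<le> t \<Longrightarrow> \<bar>u t (add_mset x \<xi>) - u t \<xi>\<bar> \<le> exp (- ((1 - b) * t))"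
  using increment_decay[OF g_meas g_osc] by (simp add: u_def)

lemma excess_bound:
  "\<bar>excess \<xi> t\<bar> \<le> indicator {0..} t * exp (- ((1 - b) * t)) * (real (size \<xi>) + a / (1 - b))"
  using P_exponential_ergodicity[OF g_meas g_osc, of t \<xi>]
  by (auto simp: excess_def u_def mean_def indicator_def)

lemma excess_integrable: "integrable lborel (excess \<xi>)"
proof (rule Bochner_Integration.integrable_bound)
  show "integrable lborel (\<lambda>t. indicator {0..} t * exp (- ((1 - b) * t)) * (real (size \<xi>) + a / (1 - b)))"
    by (intro integrable_mult_left integrable_exp_decay)
  show "excess \<xi> \<in> borel_measurable lborel"
    unfolding excess_def[abs_def] using u_measurable_time[of \<xi>] by measurable
qed (use excess_bound[of \<xi>] in \<open>auto intro!: AE_I2 order_trans[OF _ abs_ge_self]\<close>)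

lemma excess_diff_bound:
  "\<bar>excess (add_mset x \<xi>) t - excess \<xi> t\<bar> \<le> indicator {0..} t * exp (- ((1 - b) * t))"
  using u_increment_decay[of t x \<xi>] by (auto simp: excess_def indicator_def)

lemma h_growth: "\<bar>h \<xi>\<bar> \<le> decay_mass * (real (size \<xi>) + a / (1 - b))"
proof -
  have "\<bar>h \<xi>\<bar> \<le> (\<integral>t. \<bar>excess \<xi> t\<bar> \<partial>lborel)"
    unfolding h_def by (simp add: integral_abs_bound)
  also have "\<dots> \<le> (\<integral>t. indicator {0..} t * exp (- ((1 - b) * t)) * (real (size \<xi>) + a / (1 - b)) \<partial>lborel)"
    using excess_integrable integrable_exp_decay by (intro integral_mono excess_bound) auto
  also have "\<dots> = decay_mass * (real (size \<xi>) + a / (1 - b))"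
    by (simp add: decay_mass_def)
  finally show ?thesis .
qed

lemma h_increment_bound: "\<bar>h (add_mset x \<xi>) - h \<xi>\<bar> \<le> decay_mass"
proof -
  have "h (add_mset x \<xi>) - h \<xi> = - (\<integral>t. excess (add_mset x \<xi>) t - excess \<xi> t \<partial>lborel)"
    by (simp add: h_def excess_integrable)
  also have "\<bar>\<dots>\<bar> \<le> (\<integral>t. \<bar>excess (add_mset x \<xi>) t - excess \<xi> t\<bar> \<partial>lborel)"
    by (simp add: integral_abs_bound)
  also have "\<dots> \<le> decay_mass"
    unfolding decay_mass_def
    using excess_integrable integrable_exp_decay by (intro integral_mono excess_diff_bound) auto
  finally show ?thesis .
qed

text \<open>Exchanges the time integral in \<open>h\<close> with the birth integral of the
  generator. The increment, unlike its two terms, has a dominating function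
  \<open>exp (- ((1 - b) * t))\<close> free of \<open>x\<close> and \<xi>.\<close>

lemma h_Fubini:
  shows "integrable \<mu> (\<lambda>x. h (add_mset x \<xi>))"
    and "integrable lborel (\<lambda>t. \<integral>x. excess (add_mset x \<xi>) t - excess \<xi> t \<partial>\<mu>)"
    and "(\<integral>t. (\<integral>x. excess (add_mset x \<xi>) t - excess \<xi> t \<partial>\<mu>) \<partial>lborel) =
      - (\<integral>x. (h (add_mset x \<xi>) - h \<xi>) \<partial>\<mu>)"
proof -
  interpret pair_sigma_finite lborel \<mu>
    by (simp add: pair_sigma_finite_def lborel.sigma_finite_measure_axioms \<mu>.sigma_finite_measure_axioms)
  let ?F = "\<lambda>t x. excess (add_mset x \<xi>) t - excess \<xi> t"
  have Fe: "?F t x = indicator {0..} t * (u t (add_mset x \<xi>) - u t \<xi>)" for t x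
    by (simp add: excess_def algebra_simps)
  have m: "case_prod ?F \<in> borel_measurable (lborel \<Otimes>\<^sub>M \<mu>)"
    unfolding Fe using u_joint_measurable[of \<xi>] u_measurable_time[of \<xi>] by measurable
  have Fx: "integrable \<mu> (?F t)" for t
    unfolding Fe using u_integrable[of t \<xi>] by simp
  have Fi: "integrable (lborel \<Otimes>\<^sub>M \<mu>) (case_prod ?F)"
  proof (rule Fubini_integrable[OF m])
    show "integrable lborel (\<lambda>t. \<integral>x. norm (case_prod ?F (t, x)) \<partial>\<mu>)"
    proof (rule Bochner_Integration.integrable_bound[OF integrable_exp_decay])
      show "(\<lambda>t. \<integral>x. norm (case_prod ?F (t, x)) \<partial>\<mu>) \<in> borel_measurable lborel"
        using m by measurable
      have "(\<integral>x. \<bar>?F t x\<bar> \<partial>\<mu>) \<le> (\<integral>x. indicator {0..} t * exp (- ((1 - b) * t)) \<partial>\<mu>)" for t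
        using Fx by (intro integral_mono excess_diff_bound) auto
      then show "AE t in lborel. norm (\<integral>x. norm (case_prod ?F (t, x)) \<partial>\<mu>) \<le>
          norm (indicator {0..} t * exp (- ((1 - b) * t)))"
        by (auto simp: \<mu>.prob_space)
    qed
  qed (simp add: Fx)
  have inner: "(\<integral>t. ?F t x \<partial>lborel) = - (h (add_mset x \<xi>) - h \<xi>)" for x
    by (simp add: h_def excess_integrable)
  have "integrable \<mu> (\<lambda>x. - (\<integral>t. ?F t x \<partial>lborel) + h \<xi>)"
    using integrable_snd[OF Fi] by simp
  then show "integrable \<mu> (\<lambda>x. h (add_mset x \<xi>))"
    unfolding inner by simp
  show "integrable lborel (\<lambda>t. \<integral>x. excess (add_mset x \<xi>) t - excess \<xi> t \<partial>\<mu>)"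
    using integrable_fst[OF Fi] by simp
  have "(\<integral>t. (\<integral>x. ?F t x \<partial>\<mu>) \<partial>lborel) = (\<integral>x. (\<integral>t. ?F t x \<partial>lborel) \<partial>\<mu>)"
    using Fubini_integral[OF Fi] by simp
  also have "\<dots> = - (\<integral>x. (h (add_mset x \<xi>) - h \<xi>) \<partial>\<mu>)"
    by (simp only: inner Bochner_Integration.integral_minus)
  finally show "(\<integral>t. (\<integral>x. ?F t x \<partial>\<mu>) \<partial>lborel) = - (\<integral>x. (h (add_mset x \<xi>) - h \<xi>) \<partial>\<mu>)" .
qed

lemma gen_u_continuous: "continuous_on UNIV (\<lambda>t. gen (u t) \<xi>)"
proof -
  have "continuous_on UNIV (\<lambda>t. \<integral>x. (u t (add_mset x \<xi>) - u t \<xi>) \<partial>\<mu>)"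
    unfolding continuous_on_sequentially
  proof (intro allI ballI impI, elim conjE)
    fix s :: "nat \<Rightarrow> real" and t assume s: "s \<longlonglongrightarrow> t"
    have lim: "(\<lambda>n. u (s n) \<xi>) \<longlonglongrightarrow> u t \<xi>" for \<xi>
      using s by (auto intro!: continuous_on_tendsto_compose[OF u_continuous s])
    have "(\<lambda>n. \<integral>x. (u (s n) (add_mset x \<xi>) - u (s n) \<xi>) \<partial>\<mu>) \<longlonglongrightarrow>
        (\<integral>x. (u t (add_mset x \<xi>) - u t \<xi>) \<partial>\<mu>)"
    proof (rule integral_dominated_convergence[where w = "\<lambda>_. 2 * (\<bar>g {#}\<bar> + 1)"])
      fix n
      have "\<bar>u (s n) (add_mset x \<xi>) - u (s n) \<xi>\<bar> \<le> 2 * (\<bar>g {#}\<bar> + 1)" for x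
        using abs_triangle_ineq4[of "u (s n) (add_mset x \<xi>)" "u (s n) \<xi>"]
          add_mono[OF u_bound[of "s n" "add_mset x \<xi>"] u_bound[of "s n" \<xi>]] by simp
      then show "AE x in \<mu>. norm (u (s n) (add_mset x \<xi>) - u (s n) \<xi>) \<le> 2 * (\<bar>g {#}\<bar> + 1)" by simp
    qed (use u_integrable in \<open>auto intro!: tendsto_intros lim borel_measurable_diff\<close>)
    then show "((\<lambda>t. \<integral>x. (u t (add_mset x \<xi>) - u t \<xi>) \<partial>\<mu>) \<circ> s) \<longlonglongrightarrow>
        (\<integral>x. (u t (add_mset x \<xi>) - u t \<xi>) \<partial>\<mu>)" by (simp add: o_def)
  qed
  then show ?thesis
    unfolding bd_generator_def by (intro continuous_intros continuous_on_sum_mset u_continuous)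
qed

text \<open>The integrated backward equation. Only right derivatives of \<open>u\<close> are at
  hand, so the difference \<open>\<phi>\<close> of both sides, whose right derivative is 0, is shown
  to be constant by the one-sided monotonicity criterion applied to \<open>\<phi>\<close> and
  \<open>- \<phi>\<close>.\<close>

lemma u_eq_integral:
  assumes "0 \<le> T"
  shows "u T \<xi> - g \<xi> = integral {0..T} (\<lambda>t. gen (u t) \<xi>)"
proof -
  define \<phi> where "\<phi> t = u t \<xi> - integral {0..t} (\<lambda>t. gen (u t) \<xi>)" for t
  have cont: "continuous_on {0..T} (\<lambda>t. gen (u t) \<xi>)" "continuous_on {0..T} (\<lambda>t. u t \<xi>)" for T
    by (rule continuous_on_subset[OF gen_u_continuous] continuous_on_subset[OF u_continuous], simp)+
  have c\<phi>: "continuous_on {0..T} \<phi>"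
    unfolding \<phi>_def
    by (intro continuous_on_diff cont indefinite_integral_continuous_1 integrable_continuous_real)
  have der: "(\<phi> has_real_derivative 0) (at_right t)" if t: "0 \<le> t" "t < T" for t
  proof -
    have "((\<lambda>s. P s g \<xi>) has_real_derivative gen (u t) \<xi>) (at_right t)"
      using P_right_derivative[OF t(1) g_meas g_bound] t by (simp add: u_def)
    then have 1: "((\<lambda>s. u s \<xi>) has_real_derivative gen (u t) \<xi>) (at_right t)"
      by (rule has_field_derivative_cong_eventually[THEN iffD1, rotated 2])
        (use t in \<open>auto simp: u_def eventually_at_filter\<close>)
    have "((\<lambda>s. integral {0..s} (\<lambda>t. gen (u t) \<xi>)) has_real_derivative gen (u t) \<xi>) (at t within {0..T})"
      using t by (intro integral_has_real_derivative cont) auto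
    then have "((\<lambda>s. integral {0..s} (\<lambda>t. gen (u t) \<xi>)) has_real_derivative gen (u t) \<xi>) (at t within {t<..<T})"
      by (rule has_field_derivative_subset) (use t in auto)
    moreover have "at t within {t<..<T} = at_right t"
      using t by (intro at_within_nhd[of _ "{..<T}"]) auto
    ultimately have 2: "((\<lambda>s. integral {0..s} (\<lambda>t. gen (u t) \<xi>)) has_real_derivative gen (u t) \<xi>) (at_right t)"
      by simp
    show ?thesis unfolding \<phi>_def using DERIV_diff[OF 1 2] by simp
  qed
  have "\<phi> T \<le> \<phi> 0"
    by (rule right_derivative_nonpos_imp_le[OF assms c\<phi> der]) auto
  moreover have "- \<phi> T \<le> - \<phi> 0"
    by (rule right_derivative_nonpos_imp_le[OF assms, where D = "\<lambda>_. 0"])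
      (use c\<phi> DERIV_minus[OF der] in \<open>auto intro!: continuous_intros\<close>)
  moreover have "\<phi> 0 = g \<xi>" by (simp add: \<phi>_def u_def P_0[OF g_meas])
  ultimately show ?thesis by (simp add: \<phi>_def)
qed

lemma u_tendsto_mean: "((\<lambda>T. u T \<xi>) \<longlongrightarrow> mean) at_top"
proof (rule LIM_zero_cancel, rule Lim_null_comparison)
  show "\<forall>\<^sub>F t in at_top. norm (u t \<xi> - mean) \<le> exp (- ((1 - b) * t)) * (real (size \<xi>) + a / (1 - b))"
    using eventually_ge_at_top[of 0]
    by eventually_elim (use P_exponential_ergodicity[OF g_meas g_osc] in \<open>simp add: u_def mean_def\<close>)
  have "((\<lambda>t. exp (- ((1 - b) * t))) \<longlongrightarrow> 0) at_top" using b_less by real_asymp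
  then show "((\<lambda>t. exp (- ((1 - b) * t)) * (real (size \<xi>) + a / (1 - b))) \<longlongrightarrow> 0) at_top"
    by (rule tendsto_mult_left_zero)
qed

text \<open>Let \<open>T\<close> tend to infinity in the integrated backward equation: the left side
  tends to \<open>mean - g \<xi>\<close>. On the right the constant \<open>mean\<close> drops out of
  all differences in the generator, so integrating these over time yields
  \<open>- gen h \<xi>\<close>.\<close>

theorem poisson_equation: "gen h \<xi> = g \<xi> - mean"
proof -
  let ?G = "\<lambda>t. gen (u t) \<xi>"
  let ?\<alpha> = "a + b * real (size \<xi>)" and ?\<gamma> = "1 + \<beta> * (real (size \<xi>) - 1)"
  have G: "indicator {0..} t * ?G t =
      ?\<alpha> * (\<integral>x. excess (add_mset x \<xi>) t - excess \<xi> t \<partial>\<mu>) +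
      ?\<gamma> * (\<Sum>w\<in>#\<xi>. (excess (\<xi> - {#w#}) t - excess \<xi> t))" for t
    by (cases "0 \<le> t") (simp_all add: excess_def bd_generator_def)
  have "has_bochner_integral lborel (\<lambda>t. excess (\<xi> - {#w#}) t - excess \<xi> t) (- (h (\<xi> - {#w#}) - h \<xi>))" for w
    by (simp add: has_bochner_integral_iff excess_integrable h_def)
  then have "has_bochner_integral lborel (\<lambda>t. \<Sum>w\<in>#\<xi>. (excess (\<xi> - {#w#}) t - excess \<xi> t))
      (\<Sum>w\<in>#\<xi>. - (h (\<xi> - {#w#}) - h \<xi>))"
    by (intro has_bochner_integral_sum_mset) auto
  also have "(\<Sum>w\<in>#\<xi>. - (h (\<xi> - {#w#}) - h \<xi>)) = - (\<Sum>w\<in>#\<xi>. (h (\<xi> - {#w#}) - h \<xi>))"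
    using sum_mset_minus[of "\<lambda>_. 0" "\<lambda>w. h (\<xi> - {#w#}) - h \<xi>" \<xi>] by simp
  finally have "has_bochner_integral lborel (\<lambda>t. indicator {0..} t * ?G t)
      (?\<alpha> * (- (\<integral>x. (h (add_mset x \<xi>) - h \<xi>) \<partial>\<mu>)) + ?\<gamma> * (- (\<Sum>w\<in>#\<xi>. (h (\<xi> - {#w#}) - h \<xi>))))"
    unfolding G using h_Fubini(2,3)[of \<xi>]
    by (intro has_bochner_integral_add has_bochner_integral_mult_right)
      (auto simp: has_bochner_integral_iff)
  then have int: "has_bochner_integral lborel (\<lambda>t. indicator {0..} t * ?G t) (- gen h \<xi>)"
    by (simp add: bd_generator_def)
  have "((\<lambda>T. \<integral>t. indicator {..T} t *\<^sub>R (indicator {0..} t * ?G t) \<partial>lborel) \<longlongrightarrow>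
      (\<integral>t. indicator {0..} t * ?G t \<partial>lborel)) at_top"
    by (rule tendsto_integral_at_top) (use int in \<open>auto simp: has_bochner_integral_iff\<close>)
  moreover have "\<forall>\<^sub>F T in at_top. (\<integral>t. indicator {..T} t *\<^sub>R (indicator {0..} t * ?G t) \<partial>lborel) = u T \<xi> - g \<xi>"
    using eventually_ge_at_top[of 0]
  proof eventually_elim
    case (elim T)
    have "(\<integral>t. indicator {..T} t *\<^sub>R (indicator {0..} t * ?G t) \<partial>lborel) = (LBINT t:{0..T}. ?G t)"
      unfolding set_lebesgue_integral_def
      by (intro Bochner_Integration.integral_cong) (auto simp: indicator_def)
    also have "\<dots> = integral {0..T} ?G"
      by (intro set_borel_integral_eq_integral borel_integrable_atLeastAtMost'
          continuous_on_subset[OF gen_u_continuous]) simp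
    finally show ?case using u_eq_integral[OF elim, of \<xi>] by simp
  qed
  ultimately have "((\<lambda>T. u T \<xi> - g \<xi>) \<longlongrightarrow> (\<integral>t. indicator {0..} t * ?G t \<partial>lborel)) at_top"
    by (rule Lim_transform_eventually)
  moreover have "((\<lambda>T. u T \<xi> - g \<xi>) \<longlongrightarrow> mean - g \<xi>) at_top"
    by (intro tendsto_intros u_tendsto_mean)
  ultimately have "(\<integral>t. indicator {0..} t * ?G t \<partial>lborel) = mean - g \<xi>"
    by (rule tendsto_unique[OF trivial_limit_at_top_linorder])
  then show ?thesis using int by (simp add: has_bochner_integral_iff)
qed

end

section \<open>Bounds for solutions of the Poisson equation\<close>

text \<open>Induction on the number of particles of \<eta> missing from \<zeta>: each step trades a
  surplus particle \<open>y\<close> for a missing one \<open>x\<close>, at cost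
  \<open>C\<close>.\<close>

lemma mset_swap_bound:
  fixes h :: "'a multiset \<Rightarrow> real"
  assumes C: "\<And>\<xi> x y. Suc (size \<xi>) = k \<Longrightarrow> h (add_mset x \<xi>) - h (add_mset y \<xi>) \<le> C"
    and "size \<zeta> = k" "size \<eta> = k"
  shows "h \<zeta> - h \<eta> \<le> C * real (size (\<eta> - \<zeta>))"
  using assms(2)
proof (induction "size (\<eta> - \<zeta>)" arbitrary: \<zeta>)
  case 0
  then have "\<eta> \<subseteq># \<zeta>" by (simp add: Diff_eq_empty_iff_mset)
  then have "\<eta> = \<zeta>" using 0 assms(3) by (simp add: subset_mset_size_eq)
  then show ?case using 0 by simp
next
  case (Suc r)
  then have "\<eta> - \<zeta> \<noteq> {#}" by auto
  then obtain x where x: "x \<in># \<eta> - \<zeta>" by blast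
  have "size (\<zeta> - \<eta>) = Suc r"
    using size_diff_commute[of \<zeta> \<eta>] Suc(2) Suc.prems assms(3) by simp
  then have "\<zeta> - \<eta> \<noteq> {#}" by auto
  then obtain y where y: "y \<in># \<zeta> - \<eta>" by blast
  define \<xi> where "\<xi> = \<zeta> - {#y#}"
  have \<zeta>: "\<zeta> = add_mset y \<xi>" using y by (metis \<xi>_def in_diffD insert_DiffM)
  have k: "Suc (size \<xi>) = k" using Suc.prems \<zeta> by simp
  have "\<eta> - \<zeta> = add_mset x (\<eta> - add_mset x \<xi>)"
  proof (rule multiset_eqI)
    fix z
    show "count (\<eta> - \<zeta>) z = count (add_mset x (\<eta> - add_mset x \<xi>)) z"
      using x y unfolding \<zeta> in_diff_count by (auto split: if_splits)
  qed
  then have "r = size (\<eta> - add_mset x \<xi>)" using Suc(2) by simp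
  then have "h (add_mset x \<xi>) - h \<eta> \<le> C * real r"
    using Suc(1)[of "add_mset x \<xi>"] k by simp
  moreover have "h \<zeta> - h (add_mset x \<xi>) \<le> C" unfolding \<zeta> by (rule C[OF k])
  ultimately show ?case unfolding Suc(2)[symmetric] by (simp add: algebra_simps)
qed

lemma inverse_increment:
  "1 \<le> (k::real) \<Longrightarrow> 0 < s \<Longrightarrow> 1 / (s * (k + 1)) - 1 / (s * k) = - (1 / (s * k * (k + 1)))"
  by (simp add: divide_simps)

section \<open>Inequalities between birth and death rates\<close>

context bd_rates
begin

abbreviation \<alpha> :: "real \<Rightarrow> real" where "\<alpha> k \<equiv> a + b * k"
abbreviation \<gamma> :: "real \<Rightarrow> real" where "\<gamma> k \<equiv> 1 + \<beta> * (k - 1)"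
abbreviation d :: "real \<Rightarrow> real" where "d k \<equiv> k * \<gamma> k"

text \<open>\<open>d k\<close> is the total death rate in a configuration of \<open>k\<close> particles, \<open>\<gamma> k\<close> that of one particle.\<close>

lemma drift_mono:
  assumes "0 \<le> k" "k \<le> j" "1 \<le> j"
  shows "d k - \<alpha> k \<le> d j - \<alpha> j"
proof -
  have "0 \<le> (j - k) * ((1 - b) + \<beta> * (j + k - 1))"
    using assms b_less \<beta>_nonneg by (intro mult_nonneg_nonneg add_nonneg_nonneg) auto
  then show ?thesis by (simp add: algebra_simps)
qed

text \<open>States that \<open>d / \<alpha>\<close> is nondecreasing, with denominators
  cleared.\<close>

lemma death_birth_ratio_mono:
  assumes "0 \<le> k" "k \<le> j" "1 \<le> j"
  shows "d k * \<alpha> j \<le> d j * \<alpha> k"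
proof -
  have "0 \<le> a * ((j - k) * (1 + \<beta> * (j + k - 1))) + b * j * k * (\<beta> * (j - k))"
    using assms a_pos b_nonneg \<beta>_nonneg by (intro add_nonneg_nonneg mult_nonneg_nonneg) auto
  then show ?thesis by (simp add: algebra_simps)
qed

text \<open>At size \<open>j\<close> any \<open>k\<close> given particles die at total rate
  \<open>\<gamma> j * k\<close>. Relative to the drift \<open>d j - \<alpha> j\<close> this is
  largest at \<open>j = k\<close>, where equality holds. So, when the drift at \<open>k\<close> is
  positive, a linear function of slope \<open>d k / (d k - \<alpha> k)\<close> pays for these deaths
  at every size.\<close>

lemma tagged_death_rate_le:
  assumes "1 \<le> k" "k \<le> j"
  shows "(d k - \<alpha> k) * (\<gamma> j * k) \<le> d k * (d j - \<alpha> j)"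
proof -
  have "b * 1 \<le> 1 * \<gamma> j"
    using assms b_less b_nonneg \<beta>_nonneg by (intro mult_mono) auto
  then have "0 \<le> k * (\<gamma> k * (j - k) * (\<gamma> j - b) + (a + b * k) * (\<beta> * (j - k)))"
    using assms a_pos b_nonneg \<beta>_nonneg by (intro add_nonneg_nonneg mult_nonneg_nonneg) auto
  then show ?thesis by (simp add: algebra_simps)
qed

end

text \<open>The properties of \<open>h\<close> from which the bounds follow, free of the process.
  \<open>F\<close> stands for f - \<pi>(f), and \<open>m\<close> for its infimum, nonpositive
  because the mean of \<open>F\<close> is 0. \<open>K\<close> supplies the a priori bounds that the
  comparisons require.\<close>

locale poisson_solution = bd_rates a b \<beta> \<mu>
  for a b \<beta> :: real and \<mu> :: "'a::metric_space measure" +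
  fixes h F :: "'a multiset \<Rightarrow> real" and K m :: real
  assumes h_integrable: "integrable \<mu> (\<lambda>x. h (add_mset x \<xi>))"
    and h_growth: "\<bar>h \<xi>\<bar> \<le> K * (real (size \<xi>) + 1)"
    and h_increment: "\<bar>h (add_mset x \<xi>) - h \<xi>\<bar> \<le> K"
    and gen_h: "gen h \<xi> = F \<xi>"
    and F_swap: "\<bar>F (add_mset x \<xi>) - F (add_mset y \<xi>)\<bar> \<le> 1 / (real (size \<xi>) + 1)"
    and F_bounds: "m \<le> F \<xi>" "F \<xi> \<le> m + 1" and m_nonpos: "m \<le> 0"
begin

lemma K_nonneg: "0 \<le> K"
  using h_increment[of undefined "{#}"] by linarith

lemma \<gamma>_ge_1: "1 \<le> k \<Longrightarrow> 1 \<le> \<gamma> k"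
  using \<beta>_nonneg by simp

text \<open>Take \<open>x\<close> or \<open>y\<close> as the label of a tagged particle among k =
  |\<xi>| + 1. A birth leads to k + 1, the death of one of the k - 1 others to k - 1, the death of
  the tagged particle annihilates the difference, and the source is at most 1/k. The hypothesis on
  \<open>V\<close> says that \<open>V\<close> is a supersolution of this equation on sizes.\<close>

lemma swap_le_supersolution:
  assumes V: "\<And>k. 1 \<le> k \<Longrightarrow> \<alpha> k * (V (k + 1) - V k) + \<gamma> k * ((k - 1) * (V (k - 1) - V k) - V k) \<le> - (1 / k)"
    and V_nonneg: "\<And>k. 1 \<le> k \<Longrightarrow> 0 \<le> V k"
  shows "h (add_mset x \<xi>) - h (add_mset y \<xi>) \<le> V (real (size \<xi>) + 1)"
proof (rule field_le_epsilon)
  fix \<delta> :: real assume "\<delta> > 0"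
  define \<epsilon> where "\<epsilon> = \<delta> / (real (size \<xi>) + 1 + a + 2)"
  have den: "0 < real (size \<xi>) + 1 + a + 2" using a_pos by simp
  then have \<epsilon>: "\<epsilon> > 0" "\<epsilon> * (real (size \<xi>) + 1 + a + 2) = \<delta>"
    using \<open>\<delta> > 0\<close> unfolding \<epsilon>_def by (auto simp: divide_simps)
  define D where "D \<xi> x y = h (add_mset x \<xi>) - h (add_mset y \<xi>)" for \<xi> x y
  \<comment> \<open>The added term confines, since the difference is at most \<open>2 * K\<close>.
    The offset \<open>a + 2\<close> lets killing, at rate at least 1, outweigh births, so that the
    term contributes at most \<open>- \<epsilon>\<close>, the strict gain for the
    comparison.\<close>
  define W where "W k = V k + \<epsilon> * (k + a + 2)" for k
  define v where "v = (\<lambda>(\<xi>, x, y). D \<xi> x y - W (real (size \<xi>) + 1))"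
  define J where "J = 2 * K / \<epsilon>"
  have D_le: "D \<xi> x y \<le> 2 * K" for \<xi> x y
    using h_increment[of x \<xi>] h_increment[of y \<xi>] unfolding D_def by linarith
  have W_ge: "\<epsilon> * (real n + 1) \<le> W (real n + 1)" for n
    using V_nonneg[of "real n + 1"] a_pos \<epsilon>(1) by (simp add: W_def algebra_simps)
  have "v (\<xi>, x, y) \<le> 0"
  proof (rule elliptic_comparison[where v = v and I = UNIV and e = \<epsilon> and B = "2 * K" and
        Q = "\<alpha> J + (1 + \<beta> * J) * J"])
    show "v i \<le> 2 * K" for i
    proof (cases i)
      case (fields \<xi> x y)
      have "0 \<le> \<epsilon> * (real (size \<xi>) + 1)" using \<epsilon> by simp
      then show ?thesis using D_le[of \<xi> x y] W_ge[of "size \<xi>"] by (simp add: v_def fields)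
    qed
    fix i M assume pos: "0 < v i" and M: "\<And>j. j \<in> UNIV \<Longrightarrow> v j \<le> M"
    show "\<epsilon> \<le> (\<alpha> J + (1 + \<beta> * J) * J) * (M - v i)"
    proof (cases i)
      case (fields \<xi> x y)
      define n where "n = real (size \<xi>)"
      have n0: "0 \<le> n" by (simp add: n_def)
      have le: "D \<xi> x y \<le> M + W (real (size \<xi>) + 1)" for \<xi> x y
        using M[of "(\<xi>, x, y)"] by (simp add: v_def)
      have Dv: "D \<xi> x y = v i + W (n + 1)" by (simp add: v_def fields n_def)
      let ?I = "\<lambda>x. \<integral>z. (h (add_mset z (add_mset x \<xi>)) - h (add_mset x \<xi>)) \<partial>\<mu>"
      let ?S = "\<lambda>x. \<Sum>w\<in>#\<xi>. (h (add_mset x (\<xi> - {#w#})) - h (add_mset x \<xi>))"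
      have "?I x - ?I y = (\<integral>z. (D (add_mset z \<xi>) x y - D \<xi> x y) \<partial>\<mu>)"
        using h_integrable
        by (subst Bochner_Integration.integral_diff[symmetric])
          (auto simp: D_def add_mset_commute \<mu>.prob_space intro!: Bochner_Integration.integral_cong)
      also have "\<dots> \<le> (\<integral>z. (M + W (n + 2) - D \<xi> x y) \<partial>\<mu>)"
      proof (rule integral_mono)
        show "integrable \<mu> (\<lambda>z. D (add_mset z \<xi>) x y - D \<xi> x y)"
          using h_integrable[of "add_mset x \<xi>"] h_integrable[of "add_mset y \<xi>"]
          by (simp add: D_def add_mset_commute)
        show "D (add_mset z \<xi>) x y - D \<xi> x y \<le> M + W (n + 2) - D \<xi> x y" for z
          using le[of "add_mset z \<xi>" x y] by (simp add: n_def add.commute add.left_commute)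
      qed simp
      finally have I: "?I x - ?I y \<le> M + W (n + 2) - D \<xi> x y" by (simp add: \<mu>.prob_space)
      have "?S x - ?S y = (\<Sum>w\<in>#\<xi>. (D (\<xi> - {#w#}) x y - D \<xi> x y))"
        by (simp only: sum_mset_minus[symmetric] D_def) (simp add: algebra_simps)
      also have "\<dots> \<le> n * (M + W n - D \<xi> x y)"
        unfolding n_def
      proof (rule sum_mset_le)
        show "D (\<xi> - {#w#}) x y - D \<xi> x y \<le> M + W (real (size \<xi>)) - D \<xi> x y" if "w \<in># \<xi>" for w
          using le[of "\<xi> - {#w#}" x y] size_remove_real[OF that] by simp
      qed
      finally have S: "?S x - ?S y \<le> n * (M + W n - D \<xi> x y)" .
      have "- (1 / (n + 1)) \<le> gen h (add_mset x \<xi>) - gen h (add_mset y \<xi>)"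
        using F_swap[of x \<xi> y] unfolding gen_h n_def by linarith
      also have "\<dots> = \<alpha> (n + 1) * (?I x - ?I y) + (1 + \<beta> * n) * ((?S x - ?S y) - D \<xi> x y)"
        unfolding gen_add_mset n_def D_def by (simp add: algebra_simps)
      also have "\<dots> \<le> \<alpha> (n + 1) * (M + W (n + 2) - D \<xi> x y) +
          (1 + \<beta> * n) * (n * (M + W n - D \<xi> x y) - D \<xi> x y)"
        using a_pos b_nonneg \<beta>_nonneg n0
        by (intro add_mono mult_left_mono diff_right_mono I S) auto
      also have "\<dots> = (\<alpha> (n + 1) + (1 + \<beta> * n) * n) * (M - v i) - (1 + \<beta> * n) * v i +
          (\<alpha> (n + 1) * (V (n + 2) - V (n + 1)) + (1 + \<beta> * n) * (n * (V n - V (n + 1)) - V (n + 1))) +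
          \<epsilon> * (\<alpha> (n + 1) - (1 + \<beta> * n) * (2 * n + a + 3))"
        unfolding Dv W_def by (simp add: algebra_simps)
      finally have main: "- (1 / (n + 1)) \<le> (\<alpha> (n + 1) + (1 + \<beta> * n) * n) * (M - v i) - (1 + \<beta> * n) * v i +
          (\<alpha> (n + 1) * (V (n + 2) - V (n + 1)) + (1 + \<beta> * n) * (n * (V n - V (n + 1)) - V (n + 1))) +
          \<epsilon> * (\<alpha> (n + 1) - (1 + \<beta> * n) * (2 * n + a + 3))" .
      have "\<alpha> (n + 1) * (V (n + 2) - V (n + 1)) + (1 + \<beta> * n) * (n * (V n - V (n + 1)) - V (n + 1)) \<le>
          - (1 / (n + 1))"
        using V[of "n + 1"] n0 by (simp add: add.assoc)
      moreover have "\<epsilon> * (\<alpha> (n + 1) - (1 + \<beta> * n) * (2 * n + a + 3)) \<le> \<epsilon> * (- 1)"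
      proof (rule mult_left_mono)
        have "\<alpha> (n + 1) - (1 + \<beta> * n) * (2 * n + a + 3) \<le> (a + 1 * (n + 1)) - 1 * (2 * n + a + 3)"
          using b_less \<beta>_nonneg n0 a_pos by (intro diff_mono add_left_mono mult_right_mono) auto
        also have "\<dots> \<le> - 1" using n0 by simp
        finally show "\<alpha> (n + 1) - (1 + \<beta> * n) * (2 * n + a + 3) \<le> - 1" .
      qed (use \<epsilon> in simp)
      moreover have "0 \<le> (1 + \<beta> * n) * v i" using pos \<beta>_nonneg n0 by simp
      ultimately have "\<epsilon> \<le> (\<alpha> (n + 1) + (1 + \<beta> * n) * n) * (M - v i)" using main by linarith
      also have "\<dots> \<le> (\<alpha> J + (1 + \<beta> * J) * J) * (M - v i)"
      proof (rule mult_right_mono)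
        have "\<epsilon> * (n + 1) \<le> 2 * K"
          using W_ge[of "size \<xi>"] D_le[of \<xi> x y] pos by (simp add: v_def fields n_def)
        then have "n + 1 \<le> J" using \<epsilon> by (simp add: J_def field_simps)
        then show "\<alpha> (n + 1) + (1 + \<beta> * n) * n \<le> \<alpha> J + (1 + \<beta> * J) * J"
          using b_nonneg \<beta>_nonneg n0 by (intro add_mono mult_mono) auto
        show "0 \<le> M - v i" using M[of i] by simp
      qed
      finally show ?thesis .
    qed
  qed (use \<epsilon> in auto)
  then show "h (add_mset x \<xi>) - h (add_mset y \<xi>) \<le> V (real (size \<xi>) + 1) + \<delta>"
    using \<epsilon>(2) by (simp add: v_def D_def W_def add.assoc)
qed

text \<open>Killing at rate \<open>\<gamma> k \<ge> 1\<close> alone pays for the source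
  \<open>1 / k \<le> 1\<close>.\<close>

lemma swap_le_one: "h (add_mset x \<xi>) - h (add_mset y \<xi>) \<le> 1"
proof (rule swap_le_supersolution[where V = "\<lambda>_. 1"])
  fix k :: real assume k: "1 \<le> k"
  then have "1 / k \<le> 1" by simp
  then show "\<alpha> k * (1 - 1) + \<gamma> k * ((k - 1) * (1 - 1) - 1) \<le> - (1 / k)"
    using \<gamma>_ge_1[OF k] by simp
qed simp

text \<open>For k > 1 the function 1/(2k) is balanced under the deaths, as deaths of others gain
  what killing loses. It thus decreases only through births, by at least a/(2k(k+1)), while the
  constant 1/a decreases through killing, by at least 1/a. Together these cover 1/k.\<close>

lemma swap_le_half_inverse:
  "h (add_mset x \<xi>) - h (add_mset y \<xi>) \<le> 1 / (2 * (real (size \<xi>) + 1)) + 1 / a"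
proof (rule swap_le_supersolution[where V = "\<lambda>k. 1 / (2 * k) + 1 / a"])
  fix k :: real assume k: "1 \<le> k"
  let ?V = "\<lambda>k. 1 / (2 * k) + 1 / a"
  have up: "\<alpha> k * (?V (k + 1) - ?V k) \<le> - (a / (2 * k * (k + 1)))"
  proof -
    have "?V (k + 1) - ?V k = - (1 / (2 * k * (k + 1)))" using inverse_increment[of k 2] k by simp
    moreover have "a / (2 * k * (k + 1)) \<le> \<alpha> k / (2 * k * (k + 1))"
      using k b_nonneg by (intro divide_right_mono) auto
    ultimately show ?thesis by simp
  qed
  \<comment> \<open>At \<open>k = 1\<close> the value \<open>?V 0\<close>, a division by zero, is
    multiplied by 0.\<close>
  have "(k - 1) * (?V (k - 1) - ?V k) - ?V k \<le> - (1 / a)"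
    using k by (cases "k = 1") (auto simp: field_simps)
  then have "\<gamma> k * ((k - 1) * (?V (k - 1) - ?V k) - ?V k) \<le> \<gamma> k * (- (1 / a))"
    using \<gamma>_ge_1[OF k] by (intro mult_left_mono) auto
  also have "\<dots> \<le> 1 * (- (1 / a))"
    using \<gamma>_ge_1[OF k] a_pos by (intro mult_right_mono_neg) auto
  finally have down: "\<gamma> k * ((k - 1) * (?V (k - 1) - ?V k) - ?V k) \<le> - (1 / a)" by simp
  have "1 / k \<le> a / (2 * k * (k + 1)) + 1 / a"
  proof -
    \<comment> \<open>The arithmetic-geometric mean inequality for the two gains, as a completed
      square; the remainder \<open>(k + 1) * (k - 1)\<close> is where \<open>1 \<le> k\<close>
      enters.\<close>
    have "0 \<le> (a - (k + 1))\<^sup>2 + (k + 1) * (k - 1)" using k by simp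
    then have "2 * a * (k + 1) \<le> a * a + 2 * k * (k + 1)"
      by (simp add: power2_eq_square algebra_simps)
    moreover have "a / (2 * k * (k + 1)) + 1 / a - 1 / k =
        (a * a + 2 * k * (k + 1) - 2 * a * (k + 1)) / (2 * a * k * (k + 1))"
      using k a_pos by (simp add: divide_simps)
    moreover have "0 < 2 * a * k * (k + 1)" using k a_pos by simp
    ultimately have "0 \<le> a / (2 * k * (k + 1)) + 1 / a - 1 / k" by simp
    then show ?thesis by simp
  qed
  then show "\<alpha> k * (?V (k + 1) - ?V k) + \<gamma> k * ((k - 1) * (?V (k - 1) - ?V k) - ?V k) \<le> - (1 / k)"
    using up down by linarith
qed (use a_pos in simp)

text \<open>Here births alone suffice: with c = min a b they occur at rate at least c(k + 1), and
  each lowers 1/(ck) by 1/(ck(k + 1)), which together gives 1/k. Deaths contribute nothing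
  positive.\<close>

lemma swap_le_inverse:
  assumes "b \<noteq> 0"
  shows "h (add_mset x \<xi>) - h (add_mset y \<xi>) \<le> 1 / (min a b * (real (size \<xi>) + 1))"
proof (rule swap_le_supersolution[where V = "\<lambda>k. 1 / (min a b * k)"])
  define c where "c = min a b"
  have c: "0 < c" "c \<le> a" "c \<le> b" using a_pos b_nonneg assms by (auto simp: c_def)
  fix k :: real assume k: "1 \<le> k"
  let ?V = "\<lambda>k. 1 / (c * k)"
  have "\<alpha> k * (?V (k + 1) - ?V k) \<le> - (1 / k)"
  proof -
    have "?V (k + 1) - ?V k = - (1 / (c * k * (k + 1)))" using inverse_increment[of k c] k c by simp
    moreover have "c * k \<le> b * k" using c k by (intro mult_right_mono) auto
    then have "c * (k + 1) \<le> \<alpha> k" unfolding distrib_left using c(2) by linarith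
    then have "c * (k + 1) / (c * k * (k + 1)) \<le> \<alpha> k / (c * k * (k + 1))"
      using k c by (intro divide_right_mono) auto
    moreover have "c * (k + 1) / (c * k * (k + 1)) = 1 / k" using k c by (simp add: divide_simps)
    ultimately show ?thesis by simp
  qed
  moreover have "(k - 1) * (?V (k - 1) - ?V k) - ?V k \<le> 0"
    using k c by (cases "k = 1") (auto simp: field_simps)
  then have "\<gamma> k * ((k - 1) * (?V (k - 1) - ?V k) - ?V k) \<le> 0"
    using \<gamma>_ge_1[OF k] by (intro mult_nonneg_nonpos) auto
  ultimately show "\<alpha> k * (1 / (min a b * (k + 1)) - 1 / (min a b * k)) +
      \<gamma> k * ((k - 1) * (1 / (min a b * (k - 1)) - 1 / (min a b * k)) - 1 / (min a b * k)) \<le> - (1 / k)"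
    unfolding c_def[symmetric] by linarith
qed (use a_pos b_nonneg in auto)

end

section \<open>Excursions and the second difference\<close>

context poisson_solution
begin

text \<open>On sizes at least \<open>k\<close> the function \<open>h \<zeta>\<close> is compared
  with \<open>h \<eta>\<close>, plus \<open>C\<close> for every particle of \<eta> already lost,
  plus \<open>A\<close> for the expected remaining cost. In \<open>A\<close> the slope
  \<open>- m / \<delta>\<close> pays for the source, which is at least \<open>m\<close>, over the
  remaining duration, and \<open>C * s\<close> for particles of \<eta> still to be lost.\<close>

lemma excursion_above:
  assumes size_\<eta>: "real (size \<eta>) = k" "1 \<le> k" and drift: "\<alpha> k < d k"
    and C: "\<And>\<xi> x y. Suc (size \<xi>) = size \<eta> \<Longrightarrow> h (add_mset x \<xi>) - h (add_mset y \<xi>) \<le> C" and C_nonneg: "0 \<le> C"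
  shows "h (add_mset z \<eta>) - h \<eta> \<le> - m / (d k - \<alpha> k) + C * (d k / (d k - \<alpha> k))"
proof (rule field_le_epsilon)
  fix \<epsilon>' :: real assume "\<epsilon>' > 0"
  define \<delta> where "\<delta> = d k - \<alpha> k"
  define s where "s = d k / \<delta>"
  define R where "R = (2 * d k + 1) / \<delta>"
  define \<epsilon> where "\<epsilon> = \<epsilon>' / (1 + R)"
  have \<delta>: "\<delta> > 0" using drift by (simp add: \<delta>_def)
  have dk: "0 \<le> d k" using size_\<eta> \<beta>_nonneg by simp
  have R: "0 \<le> R" and s: "0 \<le> s" using \<delta> dk by (auto simp: R_def s_def)
  have \<epsilon>: "\<epsilon> > 0" "\<epsilon> * (1 + R) = \<epsilon>'" using \<open>\<epsilon>' > 0\<close> R by (auto simp: \<epsilon>_def)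
  \<comment> \<open>The last term dominates the linear growth of \<open>h\<close>; \<open>R\<close> is chosen such that the generator
    maps \<open>x * x + R * x\<close> to at most \<open>- 1\<close>.\<close>
  define A where "A x = - m * x / \<delta> + C * s * x + \<epsilon> * (x * x + R * x)" for x
  have A_up: "A (x + 1) - A x = - m / \<delta> + C * s + \<epsilon> * (2 * x + 1 + R)" for x
    by (simp add: A_def algebra_simps add_divide_distrib diff_divide_distrib)
  have A_down: "A (x - 1) - A x = m / \<delta> - C * s + \<epsilon> * (1 - 2 * x - R)" for x
    by (simp add: A_def algebra_simps add_divide_distrib diff_divide_distrib)
  define v where "v \<zeta> = h \<zeta> - h \<eta> - C * real (size (\<eta> - \<zeta>)) - A (real (size \<zeta>) - k)" for \<zeta>
  define I where "I = {\<zeta> :: 'a multiset. k \<le> real (size \<zeta>)}"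
  define H where "H = K * (k + 2) + \<bar>h \<eta>\<bar>"
  \<comment> \<open>For x = |\<zeta>| - k beyond \<open>1 + H / \<epsilon>\<close> the growth of
    \<open>h\<close> is at most H x, which the quadratic part of \<open>A\<close> exceeds, so
    \<open>v\<close> is not positive.\<close>
  define J where "J = k + 1 + H / \<epsilon>"
  have H: "0 \<le> H" using K_nonneg size_\<eta> by (simp add: H_def)
  have A_ge: "\<epsilon> * (x * x) \<le> A x" if "0 \<le> x" for x
  proof -
    have "0 \<le> - m * x" using that m_nonpos by (intro mult_nonneg_nonneg) auto
    then have "0 \<le> - m * x / \<delta>" using \<delta> by (rule divide_nonneg_pos)
    moreover have "0 \<le> C * s * x" "0 \<le> \<epsilon> * (R * x)" using that C_nonneg s \<epsilon> R by auto
    ultimately show ?thesis unfolding A_def distrib_left by linarith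
  qed
  have v_le: "v \<zeta> \<le> h \<zeta> - h \<eta> - \<epsilon> * ((real (size \<zeta>) - k) * (real (size \<zeta>) - k))" if "\<zeta> \<in> I" for \<zeta>
  proof -
    have "0 \<le> C * real (size (\<eta> - \<zeta>))" using C_nonneg by simp
    then show ?thesis using A_ge[of "real (size \<zeta>) - k"] that by (simp add: v_def I_def)
  qed
  have J: "real (size \<zeta>) \<le> J" if \<zeta>: "\<zeta> \<in> I" and pos: "0 < v \<zeta>" for \<zeta>
  proof (rule ccontr)
    assume "\<not> real (size \<zeta>) \<le> J"
    then have x: "1 + H / \<epsilon> < real (size \<zeta>) - k" by (simp add: J_def)
    define x where "x = real (size \<zeta>) - k"
    have "0 \<le> H / \<epsilon>" using H \<epsilon> by simp
    with x have x1: "1 \<le> x" "H / \<epsilon> < x" by (auto simp: x_def)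
    then have "H < \<epsilon> * x" using \<epsilon> by (simp add: field_simps)
    then have "H * x \<le> \<epsilon> * x * x" using x1 by (intro mult_right_mono) auto
    moreover have "h \<zeta> - h \<eta> \<le> H * x"
    proof -
      have "h \<zeta> - h \<eta> \<le> K * (x + (k + 1)) + \<bar>h \<eta>\<bar>"
        using h_growth[of \<zeta>] by (simp add: x_def algebra_simps)
      also have "K * (x + (k + 1)) \<le> K * ((k + 2) * x)"
      proof (rule mult_left_mono[OF _ K_nonneg])
        have "(k + 1) * 1 \<le> (k + 1) * x" using x1 size_\<eta> by (intro mult_left_mono) auto
        then show "x + (k + 1) \<le> (k + 2) * x" by (simp add: algebra_simps)
      qed
      also have "\<bar>h \<eta>\<bar> \<le> \<bar>h \<eta>\<bar> * x" using mult_left_mono[OF x1(1), of "\<bar>h \<eta>\<bar>"] by simp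
      finally show ?thesis by (simp add: H_def algebra_simps)
    qed
    ultimately show False using v_le[OF \<zeta>] pos unfolding x_def[symmetric] by (simp add: mult.assoc)
  qed
  have "v (add_mset z \<eta>) \<le> 0"
  proof (rule elliptic_comparison[where v = v and I = I and e = \<epsilon> and B = "K * (J + 1) + \<bar>h \<eta>\<bar>" and
        Q = "\<alpha> J + J * (1 + \<beta> * J)"])
    have J0: "0 \<le> J" using H \<epsilon> size_\<eta> by (simp add: J_def)
    show "v \<zeta> \<le> K * (J + 1) + \<bar>h \<eta>\<bar>" if "\<zeta> \<in> I" for \<zeta>
    proof (cases "0 < v \<zeta>")
      case True
      have "K * (real (size \<zeta>) + 1) \<le> K * (J + 1)"
        using J[OF that True] K_nonneg by (intro mult_left_mono) auto
      moreover have "0 \<le> \<epsilon> * ((real (size \<zeta>) - k) * (real (size \<zeta>) - k))" using \<epsilon> by simp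
      ultimately show ?thesis using v_le[OF that] h_growth[of \<zeta>] by linarith
    next
      case False
      have "0 \<le> K * (J + 1)" using K_nonneg J0 by simp
      then show ?thesis using False by simp
    qed
    fix \<zeta> M assume \<zeta>: "\<zeta> \<in> I" and pos: "0 < v \<zeta>" and M: "\<And>\<zeta>. \<zeta> \<in> I \<Longrightarrow> v \<zeta> \<le> M"
    define j where "j = real (size \<zeta>)"
    \<comment> \<open>The boundary of the excursion: at size \<open>k\<close> the lost particles
      have been replaced one for one, and swapping them back costs \<open>C\<close> each. Positive
      points thus have size at least k + 1, and a death stays in \<open>I\<close>.\<close>
    have "j \<noteq> k"
    proof
      assume "j = k"
      then have "size \<zeta> = size \<eta>" using size_\<eta> by (simp add: j_def)
      then have "h \<zeta> - h \<eta> \<le> C * real (size (\<eta> - \<zeta>))" using mset_swap_bound[of "size \<eta>" h C] C by blast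
      then show False using pos \<open>j = k\<close> by (simp add: v_def j_def A_def)
    qed
    then have jk: "k < j" using \<zeta> by (simp add: I_def j_def)
    then have jk1: "k + 1 \<le> j"
      using nat_less_real_le[of "size \<eta>" "size \<zeta>"] size_\<eta>(1) by (simp add: j_def)
    let ?r = "real (size (\<eta> - \<zeta>))"
    have \<gamma>j: "0 \<le> \<gamma> j" using \<beta>_nonneg jk size_\<eta> by simp
    have up: "h (add_mset x \<zeta>) \<le> M + h \<eta> + C * ?r + A (j - k + 1)" for x
    proof -
      have "size (\<eta> - add_mset x \<zeta>) \<le> size (\<eta> - \<zeta>)"
        by (intro size_mset_mono mset_subset_eqI) (simp, arith)
      then have "C * real (size (\<eta> - add_mset x \<zeta>)) \<le> C * ?r" using C_nonneg by (intro mult_left_mono) auto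
      then show ?thesis
        using M[of "add_mset x \<zeta>"] jk by (simp add: v_def I_def j_def algebra_simps)
    qed
    have I: "(\<integral>x. (h (add_mset x \<zeta>) - h \<zeta>) \<partial>\<mu>) \<le> M + h \<eta> + C * ?r + A (j - k + 1) - h \<zeta>"
      by (rule integral_increment_le[OF h_integrable up])
    have "(\<Sum>w\<in>#\<zeta>. (h (\<zeta> - {#w#}) - h \<zeta>)) - C * (\<Sum>w\<in>#\<zeta>. real (size (\<eta> - (\<zeta> - {#w#})))) =
        (\<Sum>w\<in>#\<zeta>. (h (\<zeta> - {#w#}) - h \<zeta> - C * real (size (\<eta> - (\<zeta> - {#w#})))))"
      by (simp only: sum_mset_distrib_left sum_mset_minus)
    also have "\<dots> \<le> j * (M + h \<eta> + A (j - k - 1) - h \<zeta>)"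
      unfolding j_def
    proof (rule sum_mset_le)
      fix w assume w: "w \<in># \<zeta>"
      show "h (\<zeta> - {#w#}) - h \<zeta> - C * real (size (\<eta> - (\<zeta> - {#w#}))) \<le>
          M + h \<eta> + A (real (size \<zeta>) - k - 1) - h \<zeta>"
        using M[of "\<zeta> - {#w#}"] jk1 size_remove_real[OF w] by (simp add: v_def I_def j_def algebra_simps)
    qed
    finally have "(\<Sum>w\<in>#\<zeta>. (h (\<zeta> - {#w#}) - h \<zeta>)) \<le>
        C * (\<Sum>w\<in>#\<zeta>. real (size (\<eta> - (\<zeta> - {#w#})))) + j * (M + h \<eta> + A (j - k - 1) - h \<zeta>)"
      by simp
    \<comment> \<open>Only the death of a particle of \<eta> still present increases the loss, and
      there are at most \<open>k\<close> of them.\<close>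
    also have "(\<Sum>w\<in>#\<zeta>. real (size (\<eta> - (\<zeta> - {#w#})))) \<le> j * ?r + k"
    proof -
      have "real (\<Sum>w\<in>#\<zeta>. size (\<eta> - (\<zeta> - {#w#}))) \<le> real (size \<zeta> * size (\<eta> - \<zeta>) + size \<eta>)"
        using size_diff_remove_sum[of \<eta> \<zeta>] of_nat_le_iff by blast
      then show ?thesis using size_\<eta>(1) by (simp add: j_def of_nat_sum_mset multiset.map_comp o_def)
    qed
    finally have S: "(\<Sum>w\<in>#\<zeta>. (h (\<zeta> - {#w#}) - h \<zeta>)) \<le>
        C * (j * ?r + k) + j * (M + h \<eta> + A (j - k - 1) - h \<zeta>)"
      using C_nonneg by (simp add: mult_left_mono)
    have "m \<le> gen h \<zeta>" using F_bounds[of \<zeta>] by (simp add: gen_h)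
    also have "\<dots> \<le> \<alpha> j * (M + h \<eta> + C * ?r + A (j - k + 1) - h \<zeta>) +
        \<gamma> j * (C * (j * ?r + k) + j * (M + h \<eta> + A (j - k - 1) - h \<zeta>))"
      unfolding bd_generator_def j_def[symmetric]
      using a_pos b_nonneg jk size_\<eta> \<gamma>j by (intro add_mono mult_left_mono I S) auto
    also have "\<dots> = (\<alpha> j + d j) * (M - v \<zeta>) + C * (\<gamma> j * k) +
        \<alpha> j * (A (j - k + 1) - A (j - k)) + d j * (A (j - k - 1) - A (j - k))"
      unfolding v_def j_def[symmetric] by (simp add: algebra_simps)
    also have "\<dots> = (\<alpha> j + d j) * (M - v \<zeta>) + C * (\<gamma> j * k) +
        (- m * ((\<alpha> j - d j) / \<delta>) + C * (s * (\<alpha> j - d j)) +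
        \<epsilon> * ((\<alpha> j - d j) * (2 * (j - k) + R) + \<alpha> j + d j))"
      unfolding A_up A_down by (simp add: algebra_simps add_divide_distrib diff_divide_distrib)
    finally have main: "m \<le> (\<alpha> j + d j) * (M - v \<zeta>) + C * (\<gamma> j * k) +
        (- m * ((\<alpha> j - d j) / \<delta>) + C * (s * (\<alpha> j - d j)) +
        \<epsilon> * ((\<alpha> j - d j) * (2 * (j - k) + R) + \<alpha> j + d j))" .
    \<comment> \<open>The three parts of \<open>A\<close> are accounted for separately:
      \<open>1\<close> pays for the source, \<open>2\<close> for lost particles, and
      \<open>3\<close> provides the strict gain.\<close>
    have dj: "\<delta> \<le> d j - \<alpha> j" using drift_mono[of k j] size_\<eta> jk by (simp add: \<delta>_def)
    have "- m * ((\<alpha> j - d j) / \<delta>) \<le> - m * (- 1)"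
      using dj \<delta> m_nonpos by (intro mult_left_mono) (auto simp: field_simps)
    then have 1: "- m * ((\<alpha> j - d j) / \<delta>) \<le> m" by simp
    have 2: "\<gamma> j * k \<le> s * (d j - \<alpha> j)"
      using tagged_death_rate_le[of k j] size_\<eta> jk \<delta> unfolding s_def \<delta>_def[symmetric]
      by (simp add: field_simps)
    \<comment> \<open>The square contributes \<open>\<alpha> j + d j\<close>, less than
      \<open>2 * d j\<close>. Relative to the drift \<open>d j\<close> is largest at
      \<open>j = k\<close>, which explains \<open>R\<close>.\<close>
    have 3: "(\<alpha> j - d j) * (2 * (j - k) + R) + \<alpha> j + d j \<le> - 1"
    proof -
      have "d k * \<alpha> j \<le> d j * \<alpha> k" using death_birth_ratio_mono[of k j] size_\<eta> jk by simp
      then have "d j * \<delta> \<le> d k * (d j - \<alpha> j)" by (simp add: \<delta>_def algebra_simps)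
      then have "(2 * d j + 1) * \<delta> \<le> (2 * d k + 1) * (d j - \<alpha> j)"
        using dj by (simp add: distrib_right)
      then have "2 * d j + 1 \<le> R * (d j - \<alpha> j)"
        using \<delta> by (simp add: R_def field_simps)
      moreover have "0 \<le> (d j - \<alpha> j) * (2 * (j - k))" using dj \<delta> jk by (intro mult_nonneg_nonneg) auto
      moreover have "(\<alpha> j - d j) * (2 * (j - k) + R) = - ((d j - \<alpha> j) * (2 * (j - k))) - R * (d j - \<alpha> j)"
        by (simp add: algebra_simps)
      ultimately show ?thesis using dj \<delta> by linarith
    qed
    have "C * (\<gamma> j * k) + C * (s * (\<alpha> j - d j)) \<le> 0"
    proof -
      have "C * (\<gamma> j * k) \<le> C * (s * (d j - \<alpha> j))" using 2 C_nonneg by (rule mult_left_mono)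
      then show ?thesis by (simp add: algebra_simps)
    qed
    moreover have "\<epsilon> * ((\<alpha> j - d j) * (2 * (j - k) + R) + \<alpha> j + d j) \<le> \<epsilon> * (- 1)"
      using 3 \<epsilon> by (intro mult_left_mono) auto
    ultimately have "\<epsilon> \<le> (\<alpha> j + d j) * (M - v \<zeta>)" using main 1 by linarith
    also have "\<dots> \<le> (\<alpha> J + J * (1 + \<beta> * J)) * (M - v \<zeta>)"
    proof (rule mult_right_mono)
      have "j \<le> J" using J[OF \<zeta> pos] by (simp add: j_def)
      moreover have "\<beta> * (j - 1) \<le> \<beta> * J" using \<open>j \<le> J\<close> \<beta>_nonneg by (intro mult_left_mono) auto
      ultimately show "\<alpha> j + d j \<le> \<alpha> J + J * (1 + \<beta> * J)"
        using b_nonneg \<beta>_nonneg jk size_\<eta> \<gamma>j J0 by (intro add_mono mult_mono mult_left_mono) auto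
      show "0 \<le> M - v \<zeta>" using M[OF \<zeta>] by simp
    qed
    finally show "\<epsilon> \<le> (\<alpha> J + J * (1 + \<beta> * J)) * (M - v \<zeta>)" .
  qed (use \<epsilon> size_\<eta> in \<open>auto simp: I_def\<close>)
  moreover have "size (\<eta> - add_mset z \<eta>) = 0" by (simp add: Diff_eq_empty_iff_mset)
  ultimately have "h (add_mset z \<eta>) - h \<eta> \<le> A 1" using size_\<eta> by (simp add: v_def)
  then show "h (add_mset z \<eta>) - h \<eta> \<le> - m / (d k - \<alpha> k) + C * (d k / (d k - \<alpha> k)) + \<epsilon>'"
    unfolding A_def s_def \<delta>_def[symmetric] using \<epsilon>(2) by simp
qed

text \<open>The mirror image, with the particles foreign to \<eta> counted instead of the lost ones:
  a birth adds at most one, and deaths add none. At size \<open>k\<close> the two counts agree.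
  Sizes are at most \<open>k\<close>, so rates and \<open>h\<close> are bounded on \<open>I\<close>
  and a linear correction suffices.\<close>

lemma excursion_below:
  assumes size_\<eta>: "real (size \<eta>) = k" "1 \<le> k" and drift: "d k < \<alpha> k" and z: "z \<in># \<eta>"
    and C: "\<And>\<xi> x y. Suc (size \<xi>) = size \<eta> \<Longrightarrow> h (add_mset x \<xi>) - h (add_mset y \<xi>) \<le> C" and C_nonneg: "0 \<le> C"
  shows "h (\<eta> - {#z#}) - h \<eta> \<le> - m / (\<alpha> k - d k) + C * (\<alpha> k / (\<alpha> k - d k))"
proof (rule field_le_epsilon)
  fix \<epsilon>' :: real assume "\<epsilon>' > 0"
  define \<delta> where "\<delta> = \<alpha> k - d k"
  define s where "s = \<alpha> k / \<delta>"
  define \<epsilon> where "\<epsilon> = \<epsilon>' * \<delta>"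
  have \<delta>: "\<delta> > 0" using drift by (simp add: \<delta>_def)
  have s: "0 \<le> s" using \<delta> a_pos b_nonneg size_\<eta> by (auto simp: s_def)
  have \<epsilon>: "\<epsilon> > 0" using \<open>\<epsilon>' > 0\<close> \<delta> by (auto simp: \<epsilon>_def)
  \<comment> \<open>Multiplied by the drift, at least \<open>\<delta>\<close>, this slope covers the
    source \<open>m\<close>, the strict gain \<open>\<epsilon>\<close> and the cost
    \<open>C * \<alpha> j\<close> of births; \<open>\<epsilon> / \<delta>\<close> is the allowed
    error.\<close>
  define p where "p = (\<epsilon> - m) / \<delta> + C * s"
  have p: "0 \<le> p" using \<epsilon> m_nonpos \<delta> s C_nonneg by (simp add: p_def)
  define v where "v \<zeta> = h \<zeta> - h \<eta> - C * real (size (\<zeta> - \<eta>)) - p * (k - real (size \<zeta>))" for \<zeta>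
  define I where "I = {\<zeta> :: 'a multiset. real (size \<zeta>) \<le> k}"
  have "v (\<eta> - {#z#}) \<le> 0"
  proof (rule elliptic_comparison[where v = v and I = I and e = \<epsilon> and B = "K * (k + 1) + \<bar>h \<eta>\<bar>" and
        Q = "\<alpha> k + k * (1 + \<beta> * k)"])
    show "v \<zeta> \<le> K * (k + 1) + \<bar>h \<eta>\<bar>" if "\<zeta> \<in> I" for \<zeta>
    proof -
      have "K * (real (size \<zeta>) + 1) \<le> K * (k + 1)"
        using that K_nonneg by (intro mult_left_mono) (auto simp: I_def)
      moreover have "0 \<le> p * (k - real (size \<zeta>))" "0 \<le> C * real (size (\<zeta> - \<eta>))"
        using that p C_nonneg by (auto simp: I_def)
      ultimately show ?thesis using h_growth[of \<zeta>] unfolding v_def by linarith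
    qed
    fix \<zeta> M assume \<zeta>: "\<zeta> \<in> I" and pos: "0 < v \<zeta>" and M: "\<And>\<zeta>. \<zeta> \<in> I \<Longrightarrow> v \<zeta> \<le> M"
    define j where "j = real (size \<zeta>)"
    have "j \<noteq> k"
    proof
      assume "j = k"
      then have "size \<zeta> = size \<eta>" using size_\<eta> by (simp add: j_def)
      then have "h \<zeta> - h \<eta> \<le> C * real (size (\<zeta> - \<eta>))"
        using mset_swap_bound[of "size \<eta>" h C] C size_diff_commute by metis
      then show False using pos \<open>j = k\<close> by (simp add: v_def j_def)
    qed
    then have jk: "j < k" using \<zeta> by (simp add: I_def j_def)
    then have jk1: "j + 1 \<le> k"
      using nat_less_real_le[of "size \<zeta>" "size \<eta>"] size_\<eta>(1) by (simp add: j_def)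
    have j0: "0 \<le> j" by (simp add: j_def)
    let ?r = "real (size (\<zeta> - \<eta>))"
    have dj0: "0 \<le> d j" using death_factor_nonneg[of "size \<zeta>"] by (simp add: j_def)
    have up: "h (add_mset x \<zeta>) \<le> M + h \<eta> + C * (?r + 1) + p * (k - j - 1)" for x
    proof -
      have "size (add_mset x \<zeta> - \<eta>) \<le> size (add_mset x (\<zeta> - \<eta>))"
        by (intro size_mset_mono mset_subset_eqI) auto
      then have "C * real (size (add_mset x \<zeta> - \<eta>)) \<le> C * (?r + 1)" using C_nonneg by (intro mult_left_mono) auto
      then show ?thesis
        using M[of "add_mset x \<zeta>"] jk1 by (simp add: v_def I_def j_def algebra_simps)
    qed
    have down: "h (\<zeta> - {#w#}) \<le> M + h \<eta> + C * ?r + p * (k - j + 1)" if w: "w \<in># \<zeta>" for w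
    proof -
      have "size (\<zeta> - {#w#} - \<eta>) \<le> size (\<zeta> - \<eta>)"
        by (intro size_mset_mono mset_subset_eqI) (simp, arith)
      then have "C * real (size (\<zeta> - {#w#} - \<eta>)) \<le> C * ?r" using C_nonneg by (intro mult_left_mono) auto
      then show ?thesis
        using M[of "\<zeta> - {#w#}"] jk size_remove_real[OF w] by (simp add: v_def I_def j_def algebra_simps)
    qed
    have "m \<le> gen h \<zeta>" using F_bounds[of \<zeta>] by (simp add: gen_h)
    also have "\<dots> \<le> \<alpha> j * (M + h \<eta> + C * (?r + 1) + p * (k - j - 1) - h \<zeta>) +
        d j * (M + h \<eta> + C * ?r + p * (k - j + 1) - h \<zeta>)"
      unfolding j_def by (rule gen_le[OF h_integrable up[unfolded j_def] down[unfolded j_def]])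
    also have "\<dots> = (\<alpha> j + d j) * (M - v \<zeta>) + C * \<alpha> j + p * (d j - \<alpha> j)"
      unfolding v_def j_def[symmetric] by (simp add: algebra_simps)
    also have "p * (d j - \<alpha> j) = (\<epsilon> - m) * ((d j - \<alpha> j) / \<delta>) + C * (s * (d j - \<alpha> j))"
      by (simp add: p_def distrib_right)
    finally have main: "m \<le> (\<alpha> j + d j) * (M - v \<zeta>) + C * \<alpha> j +
        ((\<epsilon> - m) * ((d j - \<alpha> j) / \<delta>) + C * (s * (d j - \<alpha> j)))" .
    have dj: "\<delta> \<le> \<alpha> j - d j" using drift_mono[of j k] size_\<eta> jk j0 by (simp add: \<delta>_def)
    have "(\<epsilon> - m) * ((d j - \<alpha> j) / \<delta>) \<le> (\<epsilon> - m) * (- 1)"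
      using dj \<delta> m_nonpos \<epsilon> by (intro mult_left_mono) (auto simp: field_simps)
    then have "(\<epsilon> - m) * ((d j - \<alpha> j) / \<delta>) \<le> m - \<epsilon>" by simp
    moreover have "C * \<alpha> j + C * (s * (d j - \<alpha> j)) \<le> 0"
    proof -
      have "d j * \<alpha> k \<le> d k * \<alpha> j" using death_birth_ratio_mono[of j k] size_\<eta> jk j0 by simp
      then have "\<alpha> j * \<delta> \<le> \<alpha> k * (\<alpha> j - d j)" by (simp add: \<delta>_def algebra_simps)
      then have "\<alpha> j \<le> s * (\<alpha> j - d j)" using \<delta> by (simp add: s_def field_simps)
      then have "C * \<alpha> j \<le> C * (s * (\<alpha> j - d j))" using C_nonneg by (rule mult_left_mono)
      then show ?thesis by (simp add: algebra_simps)
    qed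
    ultimately have "\<epsilon> \<le> (\<alpha> j + d j) * (M - v \<zeta>)" using main by linarith
    also have "\<dots> \<le> (\<alpha> k + k * (1 + \<beta> * k)) * (M - v \<zeta>)"
    proof (rule mult_right_mono)
      have "\<beta> * (j - 1) \<le> \<beta> * k" using jk \<beta>_nonneg by (intro mult_left_mono) auto
      then have "j * \<gamma> j \<le> j * (1 + \<beta> * k)" using j0 by (intro mult_left_mono) auto
      also have "\<dots> \<le> k * (1 + \<beta> * k)" using jk size_\<eta> \<beta>_nonneg by (intro mult_right_mono) auto
      finally show "\<alpha> j + d j \<le> \<alpha> k + k * (1 + \<beta> * k)"
        using b_nonneg jk by (intro add_mono mult_left_mono) auto
      show "0 \<le> M - v \<zeta>" using M[OF \<zeta>] by simp
    qed
    finally show "\<epsilon> \<le> (\<alpha> k + k * (1 + \<beta> * k)) * (M - v \<zeta>)" .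
  qed (use \<epsilon> size_\<eta> size_remove_real[OF z] in \<open>auto simp: I_def\<close>)
  moreover have "size (\<eta> - {#z#} - \<eta>) = 0" by (simp add: Diff_eq_empty_iff_mset)
  ultimately have "h (\<eta> - {#z#}) - h \<eta> \<le> p" using size_\<eta> size_remove_real[OF z] by (simp add: v_def)
  then show "h (\<eta> - {#z#}) - h \<eta> \<le> - m / (\<alpha> k - d k) + C * (\<alpha> k / (\<alpha> k - d k)) + \<epsilon>'"
    unfolding p_def s_def \<delta>_def[symmetric] using \<delta> by (simp add: \<epsilon>_def diff_divide_distrib)
qed

text \<open>Only the term whose excursion is driven back to |\<eta>| by the drift is estimated; the
  Poisson equation eliminates the other one. Without drift that equation alone suffices, because
  \<open>F \<eta> \<le> m + 1 \<le> 1\<close>.\<close>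

lemma centered_second_difference_le:
  assumes "\<eta> \<noteq> {#}"
    and C: "\<And>\<xi> x y. Suc (size \<xi>) = size \<eta> \<Longrightarrow> h (add_mset x \<xi>) - h (add_mset y \<xi>) \<le> C" and C_nonneg: "0 \<le> C"
  shows "(\<integral>z. (h (add_mset z \<eta>) - h \<eta>) \<partial>\<mu>) +
      (\<Sum>w\<in>#\<eta>. (h (\<eta> - {#w#}) - h \<eta>)) / real (size \<eta>) \<le> 1 / a + C"
    (is "?G + ?S / _ \<le> _")
proof -
  define k where "k = real (size \<eta>)"
  define D where "D = ?S / k"
  have k: "1 \<le> k" using assms(1) by (simp add: k_def Suc_le_eq nonempty_has_size)
  have \<alpha>a: "a \<le> \<alpha> k" using b_nonneg k by simp
  have "gen h \<eta> = \<alpha> k * ?G + \<gamma> k * ?S" by (simp add: bd_generator_def k_def)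
  also have "\<gamma> k * ?S = d k * D" using k by (simp add: D_def)
  finally have eq: "\<alpha> k * ?G + d k * D = F \<eta>" by (simp add: gen_h)
  have "?G + D \<le> 1 / a + C"
  proof (cases "\<alpha> k" "d k" rule: linorder_cases)
    case less
    define \<delta> where "\<delta> = d k - \<alpha> k"
    have \<delta>: "\<delta> > 0" "d k > 0" using less \<alpha>a a_pos by (auto simp: \<delta>_def)
    have "?G \<le> (h \<eta> + (- m / \<delta> + C * (d k / \<delta>))) - h \<eta>"
      using excursion_above[OF k_def[symmetric] k less C C_nonneg] unfolding \<delta>_def
      by (intro integral_increment_le h_integrable) (simp add: algebra_simps)
    then have "\<delta> * ?G \<le> \<delta> * (- m / \<delta> + C * (d k / \<delta>))" using \<delta> by (intro mult_left_mono) auto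
    also have "\<dots> = - m + C * d k" using \<delta> by (simp add: field_simps)
    finally have "\<delta> * ?G \<le> - m + C * d k" .
    moreover have "d k * (?G + D) = F \<eta> + \<delta> * ?G" using eq by (simp add: \<delta>_def algebra_simps)
    ultimately have "d k * (?G + D) \<le> 1 + C * d k" using F_bounds(2)[of \<eta>] by linarith
    then have "?G + D \<le> 1 / d k + C" using \<delta> by (simp add: field_simps)
    also have "1 / d k \<le> 1 / a" using less \<alpha>a a_pos by (intro divide_left_mono) auto
    finally show ?thesis by simp
  next
    case greater
    define \<delta> where "\<delta> = \<alpha> k - d k"
    have \<delta>: "\<delta> > 0" "\<alpha> k > 0" using greater \<alpha>a a_pos by (auto simp: \<delta>_def)
    have "?S \<le> k * (- m / \<delta> + C * (\<alpha> k / \<delta>))"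
      using excursion_below[OF k_def[symmetric] k greater _ C C_nonneg] unfolding \<delta>_def k_def
      by (intro sum_mset_le)
    then have "D \<le> - m / \<delta> + C * (\<alpha> k / \<delta>)" using k by (simp add: D_def divide_le_eq mult.commute)
    then have "\<delta> * D \<le> \<delta> * (- m / \<delta> + C * (\<alpha> k / \<delta>))" using \<delta> by (intro mult_left_mono) auto
    also have "\<dots> = - m + C * \<alpha> k" using \<delta> by (simp add: field_simps)
    finally have "\<delta> * D \<le> - m + C * \<alpha> k" .
    moreover have "\<alpha> k * (?G + D) = F \<eta> + \<delta> * D" using eq by (simp add: \<delta>_def algebra_simps)
    ultimately have "\<alpha> k * (?G + D) \<le> 1 + C * \<alpha> k" using F_bounds(2)[of \<eta>] by linarith
    then have "?G + D \<le> 1 / \<alpha> k + C" using \<delta> by (simp add: field_simps)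
    also have "1 / \<alpha> k \<le> 1 / a" using \<alpha>a a_pos by (intro divide_left_mono) auto
    finally show ?thesis by simp
  next
    case equal
    have "\<alpha> k * (?G + D) \<le> 1" using eq equal F_bounds(2)[of \<eta>] m_nonpos by (simp add: distrib_left)
    then have "?G + D \<le> 1 / \<alpha> k" using \<alpha>a a_pos by (simp add: field_simps)
    also have "1 / \<alpha> k \<le> 1 / a" using \<alpha>a a_pos by (intro divide_left_mono) auto
    finally show ?thesis using C_nonneg by simp
  qed
  then show ?thesis by (simp add: D_def k_def)
qed

text \<open>With \<eta> = \<xi> + x the second difference is the sum of h(\<eta> + y) - h(\<eta>),
  h(\<xi>) - h(\<eta>) and h(\<eta>) - h(\<xi> + y). Averaging the first over y and the second over
  removals from \<eta> costs \<open>C\<close> each, the third is at most \<open>C\<close>, and 4 C +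
  1/a = 2/k + 5/a.\<close>

lemma second_difference_le:
  "h (add_mset x (add_mset y \<xi>)) - h (add_mset x \<xi>) - h (add_mset y \<xi>) + h \<xi> \<le>
    2 / (real (size \<xi>) + 1) + 5 / a"
proof -
  define k where "k = real (size \<xi>) + 1"
  define \<eta> where "\<eta> = add_mset x \<xi>"
  define C where "C = 1 / (2 * k) + 1 / a"
  have k: "1 \<le> k" by (simp add: k_def)
  have \<eta>: "real (size \<eta>) = k" by (simp add: \<eta>_def k_def)
  have C0: "0 \<le> C" using k a_pos by (simp add: C_def)
  have swap: "h (add_mset x \<zeta>) - h (add_mset y \<zeta>) \<le> 1 / (2 * (real (size \<zeta>) + 1)) + 1 / a" for \<zeta> x y
    by (rule swap_le_half_inverse)
  let ?G = "\<integral>z. (h (add_mset z \<eta>) - h \<eta>) \<partial>\<mu>"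
  let ?S = "\<Sum>w\<in>#\<eta>. (h (\<eta> - {#w#}) - h \<eta>)"
  have center: "?G + ?S / k \<le> 1 / a + C"
    unfolding \<eta>[symmetric]
  proof (rule centered_second_difference_le)
    fix \<zeta> :: "'a multiset" and u w assume "Suc (size \<zeta>) = size \<eta>"
    then have "real (size \<zeta>) + 1 = k" using \<eta> by (metis of_nat_Suc add.commute)
    then show "h (add_mset u \<zeta>) - h (add_mset w \<zeta>) \<le> C" using swap[of u \<zeta> w] by (simp add: C_def)
  qed (use C0 in \<open>auto simp: \<eta>_def\<close>)
  have 1: "h (add_mset y \<eta>) - h \<eta> - C \<le> ?G"
  proof -
    have "(\<integral>z. (h (add_mset y \<eta>) - h \<eta> - C) \<partial>\<mu>) \<le> ?G"
    proof (rule integral_mono)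
      fix z
      have "1 / (2 * (k + 1)) \<le> 1 / (2 * k)" using k by (intro divide_left_mono) auto
      then show "h (add_mset y \<eta>) - h \<eta> - C \<le> h (add_mset z \<eta>) - h \<eta>"
        using swap[of y \<eta> z] by (simp add: C_def \<eta>)
    qed (use h_integrable in auto)
    then show ?thesis by (simp add: \<mu>.prob_space)
  qed
  have 2: "h \<eta> - h (add_mset y \<xi>) \<le> C"
    using swap[of x \<xi> y] by (simp add: C_def \<eta>_def k_def)
  \<comment> \<open>Removing \<open>x\<close> from \<eta> gives \<xi> exactly; removing another
    \<open>w\<close> gives \<xi> with \<open>w\<close> swapped for \<open>x\<close>, over a base of
    n - 1 particles. The n swap bounds add up to at most 1/2 + n/a, which is at most k C.\<close>
  have 3: "h \<xi> - h \<eta> - C \<le> ?S / k"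
  proof -
    define n where "n = k - 1"
    have n: "n = real (size \<xi>)" by (simp add: n_def k_def)
    have "(\<Sum>w\<in>#\<xi>. (h \<xi> - h (add_mset x (\<xi> - {#w#})))) \<le> n * (1 / (2 * n) + 1 / a)"
      unfolding n
    proof (rule sum_mset_le)
      fix w assume w: "w \<in># \<xi>"
      then show "h \<xi> - h (add_mset x (\<xi> - {#w#})) \<le> 1 / (2 * real (size \<xi>)) + 1 / a"
        using swap[of w "\<xi> - {#w#}" x] size_remove_real[OF w] by simp
    qed
    also have "\<dots> \<le> 1 / 2 + n / a" using k by (cases "n = 0") (auto simp: distrib_left)
    also have "\<dots> \<le> 1 / 2 + k / a" using a_pos by (intro add_left_mono divide_right_mono) (auto simp: n_def)
    also have "\<dots> = k * C" using k by (simp add: C_def distrib_left)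
    finally have *: "(\<Sum>w\<in>#\<xi>. (h \<xi> - h (add_mset x (\<xi> - {#w#})))) \<le> k * C" .
    have "?S = (h \<xi> - h \<eta>) + (\<Sum>w\<in>#\<xi>. (h (add_mset x (\<xi> - {#w#})) - h \<eta>))"
    proof -
      have "(\<Sum>w\<in>#\<xi>. (h (\<eta> - {#w#}) - h \<eta>)) = (\<Sum>w\<in>#\<xi>. (h (add_mset x (\<xi> - {#w#})) - h \<eta>))"
        unfolding \<eta>_def
        by (intro arg_cong[where f = sum_mset] image_mset_cong) (auto simp: insert_DiffM2 diff_union_single_conv)
      then show ?thesis by (simp add: \<eta>_def)
    qed
    also have "(\<Sum>w\<in>#\<xi>. (h (add_mset x (\<xi> - {#w#})) - h \<eta>)) =
        n * (h \<xi> - h \<eta>) - (\<Sum>w\<in>#\<xi>. (h \<xi> - h (add_mset x (\<xi> - {#w#}))))"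
    proof -
      have "n * (h \<xi> - h \<eta>) = (\<Sum>w\<in>#\<xi>. (h \<xi> - h \<eta>))" by (simp add: n)
      then show ?thesis by (simp only: sum_mset_minus[symmetric]) (simp add: algebra_simps)
    qed
    finally have "k * (h \<xi> - h \<eta> - C) \<le> ?S" using * by (simp add: n_def algebra_simps)
    then show ?thesis using k by (simp add: pos_le_divide_eq mult.commute)
  qed
  have "h (add_mset x (add_mset y \<xi>)) - h (add_mset x \<xi>) - h (add_mset y \<xi>) + h \<xi> \<le> 1 / a + 4 * C"
    using center 1 2 3 by (simp add: \<eta>_def add_mset_commute)
  also have "\<dots> = 2 / k + 5 / a" by (simp add: C_def)
  finally show ?thesis by (simp add: k_def)
qed

end

section \<open>Transfer of the bounds to Stein solutions\<close>

context bd_observable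
begin

lemma decay_mass_nonneg: "0 \<le> decay_mass"
  unfolding decay_mass_def by (intro integral_nonneg_AE) auto

lemma Inf_le_g: "Inf (range g) \<le> g \<xi>"
proof (rule cInf_lower)
  have "- (\<bar>g {#}\<bar> + 1) \<le> g \<xi>" for \<xi> using g_bound[of \<xi>] by linarith
  then show "bdd_below (range g)" by (auto intro!: bdd_belowI)
qed simp

lemma mean_bounds: "Inf (range g) \<le> mean" "g \<xi> \<le> Inf (range g) + 1"
proof -
  have "(\<integral>\<eta>. Inf (range g) \<partial>\<pi>) \<le> mean"
    unfolding mean_def
    using \<pi>_integrable[OF g_meas g_bound] by (intro integral_mono Inf_le_g) auto
  then show "Inf (range g) \<le> mean" by (simp add: \<pi>.prob_space)
  have "g \<xi> - 1 \<le> g \<eta>" for \<eta> using g_osc[of \<xi> \<eta>] by linarith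
  then have "g \<xi> - 1 \<le> Inf (range g)" by (intro cInf_greatest) auto
  then show "g \<xi> \<le> Inf (range g) + 1" by simp
qed

lemma poisson_solution_h:
  assumes swap: "\<And>x y \<xi>. \<bar>g (add_mset x \<xi>) - g (add_mset y \<xi>)\<bar> \<le> 1 / (real (size \<xi>) + 1)"
  shows "poisson_solution a b \<beta> \<mu> h (\<lambda>\<xi>. g \<xi> - mean)
    (decay_mass * (1 + a / (1 - b))) (Inf (range g) - mean)"
proof
  have c: "0 \<le> a / (1 - b)" using a_pos b_less by simp
  fix \<xi> x y
  show "integrable \<mu> (\<lambda>x. h (add_mset x \<xi>))" by (rule h_Fubini)
  have "real (size \<xi>) + a / (1 - b) \<le> (1 + a / (1 - b)) * (real (size \<xi>) + 1)"
  proof -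
    have "real n + e \<le> (1 + e) * (real n + 1)" if "0 \<le> e" for e n
      using that by (simp add: algebra_simps)
    then show ?thesis using c by blast
  qed
  then have "decay_mass * (real (size \<xi>) + a / (1 - b)) \<le> decay_mass * ((1 + a / (1 - b)) * (real (size \<xi>) + 1))"
    by (rule mult_left_mono[OF _ decay_mass_nonneg])
  then show "\<bar>h \<xi>\<bar> \<le> decay_mass * (1 + a / (1 - b)) * (real (size \<xi>) + 1)"
    using h_growth[of \<xi>] by (simp add: mult.assoc)
  have "decay_mass * 1 \<le> decay_mass * (1 + a / (1 - b))"
    using c by (intro mult_left_mono decay_mass_nonneg) auto
  then show "\<bar>h (add_mset x \<xi>) - h \<xi>\<bar> \<le> decay_mass * (1 + a / (1 - b))"
    using h_increment_bound[of x \<xi>] by simp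
  show "gen h \<xi> = g \<xi> - mean" by (rule poisson_equation)
  show "\<bar>g (add_mset x \<xi>) - mean - (g (add_mset y \<xi>) - mean)\<bar> \<le> 1 / (real (size \<xi>) + 1)"
    using swap by simp
  show "Inf (range g) - mean \<le> g \<xi> - mean" using Inf_le_g[of \<xi>] by simp
  show "g \<xi> - mean \<le> Inf (range g) - mean + 1" using mean_bounds(2)[of \<xi>] by simp
  show "Inf (range g) - mean \<le> 0" using mean_bounds(1) by simp
qed

end

text \<open>The second-difference bound is one-sided; its negative counterpart is the bound for -f,
  which is again Lipschitz.\<close>

lemma stein_solution_uminus:
  "stein_solution M Z \<pi> (\<lambda>\<xi>. - f \<xi>) \<xi> = - stein_solution M Z \<pi> f \<xi>"
proof -
  have eq: "(\<integral>\<omega>. - f (Z \<xi> t \<omega>) \<partial>M \<xi>) - (\<integral>\<eta>. - f \<eta> \<partial>\<pi>) =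
      - ((\<integral>\<omega>. f (Z \<xi> t \<omega>) \<partial>M \<xi>) - (\<integral>\<eta>. f \<eta> \<partial>\<pi>))" for t
    by simp
  show ?thesis
    unfolding stein_solution_def set_lebesgue_integral_def eq
    by (simp only: scaleR_minus_right Bochner_Integration.integral_minus)
qed

lemma lipschitz_class_uminus: "f \<in> lipschitz_class \<Longrightarrow> (\<lambda>\<xi>. - f \<xi>) \<in> lipschitz_class"
  by (auto simp: lipschitz_class_def abs_minus_commute)

theorem theorem2p4:
  fixes a b \<beta> :: real
    and \<mu> :: "'a::metric_space measure"
    and M :: "'a multiset \<Rightarrow> 'w measure"
    and Z :: "'a multiset \<Rightarrow> real \<Rightarrow> 'w \<Rightarrow> 'a multiset"
    and \<pi> :: "'a multiset measure"
  assumes "compact (UNIV :: 'a set)"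
    and "\<forall>x y :: 'a. dist x y \<le> 1"
    and "prob_space \<mu>" and "sets \<mu> = sets borel"
    and "a > 0" and "0 \<le> b" and "b < 1" and "\<beta> \<ge> 0"
    and "birth_death_system a b \<beta> \<mu> M Z"
    and "invariant_distribution M Z \<pi>"
  shows "(\<forall>n. C_const M Z \<pi> n \<le>
           min 1 (min (ereal (1 / (2 * (real n + 1)) + 1 / a))
                      (if b = 0 then \<infinity> else ereal (1 / (min a b * (real n + 1)))))) \<and>
    (\<forall>f \<in> lipschitz_class. \<forall>\<xi>.
           Delta2 (stein_solution M Z \<pi> f) \<xi> \<le> ereal (2 / (real (size \<xi>) + 1) + 5 / a))"
proof -
  have solution: "\<exists>F K m. poisson_solution a b \<beta> \<mu> (stein_solution M Z \<pi> f) F K m"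
    if f: "f \<in> lipschitz_class" for f
  proof -
    have lip: "\<bar>f \<xi> - f \<eta>\<bar> \<le> d1 \<xi> \<eta>" for \<xi> \<eta> using f by (simp add: lipschitz_class_def)
    interpret birth_death_system a b \<beta> \<mu> M Z by fact
    interpret bd_rates a b \<beta> \<mu> by (rule bd_rates.intro) fact+
    interpret bd_observable a b \<beta> \<mu> M Z \<pi> f
    proof
      show "f \<in> borel_measurable config_space"
        by (rule lipschitz_class_measurable[OF assms(1) f])
      show "\<bar>f \<xi> - f \<eta>\<bar> \<le> 1" for \<xi> \<eta>
        using lip[of \<xi> \<eta>] d1_le_one[OF assms(2), of \<xi> \<eta>] by linarith
    qed fact+
    have "\<bar>f (add_mset x \<xi>) - f (add_mset y \<xi>)\<bar> \<le> 1 / (real (size \<xi>) + 1)" for x y \<xi>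
      using lip[of "add_mset x \<xi>" "add_mset y \<xi>"] d1_add_mset_le[OF assms(2), of x \<xi> y] by linarith
    from poisson_solution_h[OF this] show ?thesis unfolding h_eq_stein_solution by blast
  qed
  \<comment> \<open>Exchanging \<open>x\<close> and \<open>y\<close> turns a one-sided bound into
    one on the absolute value.\<close>
  have C: "\<bar>stein_solution M Z \<pi> f (add_mset x \<xi>) - stein_solution M Z \<pi> f (add_mset y \<xi>)\<bar> \<le> B"
    if f: "f \<in> lipschitz_class" and B: "\<And>h F K m x y. poisson_solution a b \<beta> \<mu> h F K m \<Longrightarrow>
        h (add_mset x \<xi>) - h (add_mset y \<xi>) \<le> B" for f x y \<xi> B
    using solution[OF f] B[of "stein_solution M Z \<pi> f" _ _ _ x y] B[of "stein_solution M Z \<pi> f" _ _ _ y x]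
    by (auto simp: abs_le_iff)
  have "C_const M Z \<pi> n \<le> min 1 (min (ereal (1 / (2 * (real n + 1)) + 1 / a))
      (if b = 0 then \<infinity> else ereal (1 / (min a b * (real n + 1)))))" for n
    unfolding C_const_def
  proof (rule Sup_least, clarify)
    fix f :: "'a multiset \<Rightarrow> real" and \<xi> :: "'a multiset" and x y
    assume f: "f \<in> lipschitz_class" and n: "n = size \<xi>"
    note C' = C[OF f, of \<xi> _ x y]
    show "ereal \<bar>stein_solution M Z \<pi> f (add_mset x \<xi>) - stein_solution M Z \<pi> f (add_mset y \<xi>)\<bar> \<le>
        min 1 (min (ereal (1 / (2 * (real (size \<xi>) + 1)) + 1 / a))
          (if b = 0 then \<infinity> else ereal (1 / (min a b * (real (size \<xi>) + 1)))))"
      using C'[OF poisson_solution.swap_le_one] C'[OF poisson_solution.swap_le_half_inverse]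
        C'[OF poisson_solution.swap_le_inverse]
      by (auto simp: one_ereal_def)
  qed
  moreover have "Delta2 (stein_solution M Z \<pi> f) \<xi> \<le> ereal (2 / (real (size \<xi>) + 1) + 5 / a)"
    if f: "f \<in> lipschitz_class" for f \<xi>
    unfolding Delta2_def
  proof (rule SUP_least, clarify)
    fix x y :: 'a
    let ?h = "stein_solution M Z \<pi> f"
    obtain F K m F' K' m' where
      "poisson_solution a b \<beta> \<mu> ?h F K m"
      "poisson_solution a b \<beta> \<mu> (stein_solution M Z \<pi> (\<lambda>\<xi>. - f \<xi>)) F' K' m'"
      using solution[OF f] solution[OF lipschitz_class_uminus[OF f]] by blast
    from this[THEN poisson_solution.second_difference_le, of y x \<xi>]
    show "ereal \<bar>?h (\<xi> + {#x#} + {#y#}) - ?h (\<xi> + {#x#}) - ?h (\<xi> + {#y#}) + ?h \<xi>\<bar> \<le>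
        ereal (2 / (real (size \<xi>) + 1) + 5 / a)"
      by (simp add: stein_solution_uminus abs_le_iff)
  qed
  ultimately show ?thesis by blast
qed

end
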